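(* Let $\mathcal P$ be a set of prime numbers (possibly empty), let $S$ be the inverse semigroup associated to the self-similar action on $X^*$, $X=A\times\mathbb N$, of the group $G=\bigoplus_{p\in\mathcal P}C_p\times C_p$ constructed from $\mathcal P$ as described in the context, and let $K$ be a field. Then the contracted semigroup algebra $K_0S$ is simple if and only if the characteristic of $K$ does not belong to $\mathcal P$. In particular, if $\mathcal P$ consists of all primes, then $K_0S$ is only simple in characteristic zero.
   Context: Construction. $C_p$ is a cyclic group of order $p$ and $G=\bigoplus_{p\in\mathcal P}(C_p\times C_p)$. For $p\in\mathcal P$ let $A_p=\coprod_{[G:G_0]=p}G/G_0$ be the disjoint union of the coset spaces of all subgroups $G_0\le G$ of index $p$, and $A=\coprod_{p\in\mathcal P}A_p$, with $G$ acting on $A$ by translation of cosets. Let $\pi_p:G\to G$ be the homomorphism replacing the $p$-component of an element by $1$ and keeping the other components. Let $X=A\times\mathbb N$ and define $g(a,i)=(g(a),i)$ and $g|_{(a,i)}=\pi_p(g)$ for $g\in G$, $a\in A_p$, $i\in\mathbb N$. Extend to the free monoid $X^*$ (with empty word $\varepsilon$) by $g(\varepsilon)=\varepsilon$, $g|_\varepsilon=g$, $g(xu)=g(x)\,g|_x(u)$, $g|_{xu}=(g|_x)|_u$ for $x\in X$, $u\in X^*$. This is a faithful self-similar action. The associated inverse semigroup $S$ (the inverse hull of the left cancellative monoid $X^*G$, with zero) consists of $0$ and the formal elements $ugv^*$ ($u,v\in X^*$, $g\in G$, distinct triples giving distinct elements), with $0$ a zero and $(ugv^* )(whz^* )=(u\,g(w'))\,(g|_{w'}h)\,z^*$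 if $w=vw'$; $(ugv^* )(whz^* )=u\,(g\,h|_{h^{-1}(v')})\,(z\,h^{-1}(v'))^*$ if $v=wv'$; and $0$ otherwise. The contracted algebra $K_0S$ is the $K$-algebra with basis $S\setminus\{0\}$ and multiplication extending that of $S$, the zero of $S$ being identified with $0$. An algebra is simple if it is non-zero and has no two-sided ideals other than $0$ and itself. *)

theory Defs
  imports "HOL-Algebra.Product_Groups" "HOL-Algebra.Left_Coset" "HOL-Algebra.Ideal" "HOL-Algebra.Module"
    "HOL-Computational_Algebra.Primes" "HOL-Library.Poly_Mapping" "HOL-Library.Sublist"
begin

text \<open>
  A self-similar action of \<open>G\<close> is given on letters by \<open>\<sigma> g x = g(x)\<close> and the restriction
  \<open>\<rho> g x = g|\<^sub>x\<close>; words over \<open>X\<close> are the elements of \<^term>\<open>lists X\<close>.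
\<close>

fun word_act :: "('g \<Rightarrow> 'x \<Rightarrow> 'x) \<Rightarrow> ('g \<Rightarrow> 'x \<Rightarrow> 'g) \<Rightarrow> 'g \<Rightarrow> 'x list \<Rightarrow> 'x list" where
  "word_act \<sigma> \<rho> g [] = []"
| "word_act \<sigma> \<rho> g (x # u) = \<sigma> g x # word_act \<sigma> \<rho> (\<rho> g x) u"

fun word_res :: "('g \<Rightarrow> 'x \<Rightarrow> 'g) \<Rightarrow> 'g \<Rightarrow> 'x list \<Rightarrow> 'g" where
  "word_res \<rho> g [] = g"
| "word_res \<rho> g (x # u) = word_res \<rho> (\<rho> g x) u"

text \<open>
  \<^term>\<open>None\<close> is the zero of the inverse semigroup and \<^term>\<open>Some (u, g, v)\<close> is \<open>u g v\<^sup>*\<close>.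
\<close>

fun hull_mult ::
  "'g monoid \<Rightarrow> ('g \<Rightarrow> 'x \<Rightarrow> 'x) \<Rightarrow> ('g \<Rightarrow> 'x \<Rightarrow> 'g) \<Rightarrow>
   ('x list \<times> 'g \<times> 'x list) option \<Rightarrow> ('x list \<times> 'g \<times> 'x list) option \<Rightarrow>
   ('x list \<times> 'g \<times> 'x list) option" where
  "hull_mult G \<sigma> \<rho> (Some (u, g, v)) (Some (w, h, z)) =
    (if prefix v w then
       let w' = drop (length v) w
       in Some (u @ word_act \<sigma> \<rho> g w', word_res \<rho> g w' \<otimes>\<^bsub>G\<^esub> h, z)
     else if prefix w v then
       let v' = drop (length w) v; t = word_act \<sigma> \<rho> (m_inv G h) v'
       in Some (u, g \<otimes>\<^bsub>G\<^esub> word_res \<rho> h t, z @ t)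
     else None)"
| "hull_mult G \<sigma> \<rho> _ _ = None"

definition inverse_hull ::
  "'g monoid \<Rightarrow> 'x set \<Rightarrow> ('g \<Rightarrow> 'x \<Rightarrow> 'x) \<Rightarrow> ('g \<Rightarrow> 'x \<Rightarrow> 'g) \<Rightarrow>
   ('x list \<times> 'g \<times> 'x list) option monoid" where
  "inverse_hull G X \<sigma> \<rho> =
    \<lparr>carrier = insert None (Some ` (lists X \<times> carrier G \<times> lists X)),
     monoid.mult = hull_mult G \<sigma> \<rho>,
     one = Some ([], \<one>\<^bsub>G\<^esub>, [])\<rparr>"

text \<open>
  The contracted algebra of a monoid \<open>S\<close> with zero \<open>z\<close>: formal linear combinations of
  elements of \<open>S\<close> other than \<open>z\<close>.  The field of scalars is the type \<open>'k\<close>.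
\<close>

definition contracted_algebra ::
  "('s, 'm) monoid_scheme \<Rightarrow> 's \<Rightarrow> ('k::field, 's \<Rightarrow>\<^sub>0 'k) module" where
  "contracted_algebra S z =
    \<lparr>carrier = {f. Poly_Mapping.keys f \<subseteq> carrier S - {z}},
     monoid.mult = (\<lambda>f g. \<Sum>s\<in>Poly_Mapping.keys f. \<Sum>t\<in>Poly_Mapping.keys g.
       if s \<otimes>\<^bsub>S\<^esub> t = z then 0
       else Poly_Mapping.single (s \<otimes>\<^bsub>S\<^esub> t) (Poly_Mapping.lookup f s * Poly_Mapping.lookup g t)),
     one = Poly_Mapping.single \<one>\<^bsub>S\<^esub> 1,
     zero = 0,
     add = (+),
     smult = (\<lambda>c. Poly_Mapping.map ((*) c))\<rparr>"

text \<open>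
  Ideals of an algebra are ring ideals that are also subspaces.  The predicate \<^term>\<open>ideal\<close>
  implies \<^term>\<open>ring\<close>; requiring \<^term>\<open>ring\<close> explicitly keeps simplicity from holding
  vacuously for structures that are not rings.
\<close>

definition simple_algebra :: "('k::field, 'a, 'm) module_scheme \<Rightarrow> bool" where
  "simple_algebra R \<longleftrightarrow>
    ring R \<and> carrier R \<noteq> {\<zero>\<^bsub>R\<^esub>} \<and>
    (\<forall>I. ideal I R \<and> (\<forall>c. \<forall>x\<in>I. c \<odot>\<^bsub>R\<^esub> x \<in> I) \<longrightarrow> I = {\<zero>\<^bsub>R\<^esub>} \<or> I = carrier R)"

type_synonym elt = "nat \<Rightarrow> int \<times> int"

definition group_of :: "nat set \<Rightarrow> elt monoid" where
  "group_of P = sum_group P (\<lambda>p. integer_mod_group p \<times>\<times> integer_mod_group p)"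

text \<open>
  The elements of \<open>A\<^sub>p\<close> are the pairs \<open>(H, C)\<close> of a subgroup \<open>H\<close> of index \<open>p\<close> and a coset \<open>C\<close>
  of \<open>H\<close>, and a letter is \<open>((p, H, C), i)\<close>.  For \<open>p\<close> positive, cardinality \<open>p\<close> includes that
  the set of cosets is finite.
\<close>

type_synonym letter = "(nat \<times> elt set \<times> elt set) \<times> nat"

definition cosets_of_index :: "nat set \<Rightarrow> nat \<Rightarrow> (elt set \<times> elt set) set" where
  "cosets_of_index P p =
    (SIGMA H : {H. subgroup H (group_of P) \<and> card (lcosets\<^bsub>group_of P\<^esub> H) = p}.
       lcosets\<^bsub>group_of P\<^esub> H)"

definition letters :: "nat set \<Rightarrow> letter set" where
  "letters P = (SIGMA p : P. cosets_of_index P p) \<times> UNIV"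

fun letter_act :: "nat set \<Rightarrow> elt \<Rightarrow> letter \<Rightarrow> letter" where
  "letter_act P g ((p, H, C), i) = ((p, H, g <#\<^bsub>group_of P\<^esub> C), i)"

text \<open>The restriction at a letter over \<open>p\<close> is \<open>\<pi>\<^sub>p(g)\<close>; the identity of \<open>C\<^sub>p \<times> C\<^sub>p\<close> is \<open>(0, 0)\<close>.\<close>

fun letter_res :: "elt \<Rightarrow> letter \<Rightarrow> elt" where
  "letter_res g ((p, H, C), i) = g(p := (0, 0))"

definition semigroup_of :: "nat set \<Rightarrow> (letter list \<times> elt \<times> letter list) option monoid" where
  "semigroup_of P = inverse_hull (group_of P) (letters P) (letter_act P) letter_res"

end

theory Submission
  imports Defs "HOL-Algebra.Multiplicative_Group" "HOL-Number_Theory.Cong"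
begin

text \<open>
  Every element of the group \<open>G\<close> is carried by finitely many primes.  Let \<open>f\<close> be a non-zero element
  of an ideal.  Multiplying \<open>f\<close> by \<open>(u\<^sub>0 y)\<^sup>*\<close> on the left and by \<open>v\<^sub>0 x\<close> on the right, with \<open>u\<^sub>0\<close>
  a shortest left word of \<open>f\<close> and with letters \<open>x\<close>, \<open>y\<close> over \<open>p\<close> whose index is new, isolates
  \<open>\<Sum> c\<^sub>g \<pi>\<^sub>p(g)\<close> over the \<open>g\<close> in one coset of a subgroup of index \<open>p\<close>.  If all of these vanished, the
  sums of the coefficients along all affine lines of \<open>C\<^sub>p \<times> C\<^sub>p\<close> would vanish; adding up the \<open>p + 1\<close>
  lines through a point gives \<open>p\<close> times the coefficient of that point, which is non-zero unless
  \<open>p\<close> is the characteristic.  Doing this for the primes in the support one after the other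
  leaves a non-zero scalar.

  If the characteristic \<open>p\<close> belongs to \<open>\<P>\<close>, the sum of the elements of \<open>C\<^sub>p \<times> C\<^sub>p\<close> acts as zero on
  the free vector space over \<open>X\<^sup>*\<close>: the number of elements of \<open>C\<^sub>p \<times> C\<^sub>p\<close> carrying a given word to
  another given word is a multiple of \<open>p\<close>.  So the kernel of this representation is a proper
  non-zero ideal.
\<close>

subsection \<open>Contracted algebras\<close>

text \<open>Taking one key out of the support leaves a smaller support that still lies in
  \<open>B\<close>, so induction on the number of keys applies. Multilinear identities are reduced
  to basis vectors in this way.\<close>

lemma in_span_induct [consumes 1, case_names zero single add]:
  fixes f :: "'s \<Rightarrow>\<^sub>0 'k::comm_monoid_add"
  assumes f: "Poly_Mapping.keys f \<subseteq> B" and zero: "P 0"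
    and single: "\<And>s c. s \<in> B \<Longrightarrow> P (Poly_Mapping.single s c)"
    and add: "\<And>f g. Poly_Mapping.keys f \<subseteq> B \<Longrightarrow> Poly_Mapping.keys g \<subseteq> B \<Longrightarrow> P f \<Longrightarrow> P g \<Longrightarrow> P (f + g)"
  shows "P f"
  using f
proof (induction "card (Poly_Mapping.keys f)" arbitrary: f rule: less_induct)
  case less
  show ?case
  proof (cases "Poly_Mapping.keys f = {}")
    case False
    then obtain s where s: "s \<in> Poly_Mapping.keys f" by blast
    define g where "g = Poly_Mapping.update s 0 f"
    have g: "Poly_Mapping.lookup g t = (if t = s then 0 else Poly_Mapping.lookup f t)" for t
      by (simp add: g_def lookup_update)
    have eq: "f = Poly_Mapping.single s (Poly_Mapping.lookup f s) + g"
      by (rule poly_mapping_eqI) (auto simp: g lookup_add lookup_single when_def)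
    have keys: "Poly_Mapping.keys g = Poly_Mapping.keys f - {s}"
      by (auto simp: in_keys_iff g split: if_splits)
    then have "card (Poly_Mapping.keys g) < card (Poly_Mapping.keys f)"
      using s by (metis card_Diff1_less finite_keys)
    then have "P g" using less keys by blast
    then show ?thesis
      using s less.prems keys single[of s] by (subst eq, intro add) (auto split: if_splits)
  qed (use zero in simp)
qed

text \<open>\<open>\<one> \<noteq> z\<close> places the unit of the algebra among its basis
  vectors.\<close>

locale monoid_with_zero = Group.monoid S for S (structure) +
  fixes z
  assumes zero_closed [simp]: "z \<in> carrier S"
    and zero_mult [simp]: "s \<in> carrier S \<Longrightarrow> z \<otimes> s = z"
    and mult_zero [simp]: "s \<in> carrier S \<Longrightarrow> s \<otimes> z = z"
    and one_neq_zero [simp]: "\<one> \<noteq> z"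
begin

abbreviation algebra :: "('k::field, 'a \<Rightarrow>\<^sub>0 'k) module"
  where "algebra \<equiv> contracted_algebra S z"

text \<open>This identifies the zero of \<open>S\<close> with 0, so that a product of two basis
  vectors is always of the form \<open>basis s c\<close>, with no case distinction.\<close>

definition basis :: "'a \<Rightarrow> 'k::field \<Rightarrow> 'a \<Rightarrow>\<^sub>0 'k"
  where "basis s c = (if s = z then 0 else Poly_Mapping.single s c)"

lemma carrier_algebra: "carrier algebra = {f. Poly_Mapping.keys f \<subseteq> carrier S - {z}}"
  by (simp add: contracted_algebra_def)

lemma ops_algebra [simp]:
  "\<zero>\<^bsub>algebra\<^esub> = 0" "f \<oplus>\<^bsub>algebra\<^esub> g = f + g" "\<one>\<^bsub>algebra\<^esub> = Poly_Mapping.single \<one> 1"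
  "c \<odot>\<^bsub>algebra\<^esub> f = Poly_Mapping.map ((*) c) f"
  by (simp_all add: contracted_algebra_def)

lemma basis_0 [simp]: "basis s 0 = 0"
  by (simp add: basis_def)

lemma basis_zero [simp]: "basis z c = 0"
  by (simp add: basis_def)

lemma basis_add: "basis s (a + b) = basis s a + basis s b"
  by (simp add: basis_def single_add)

lemma mult_algebra:
  "f \<otimes>\<^bsub>algebra\<^esub> g = (\<Sum>s\<in>Poly_Mapping.keys f. \<Sum>t\<in>Poly_Mapping.keys g. basis (s \<otimes> t) (Poly_Mapping.lookup f s * Poly_Mapping.lookup g t))"
  by (simp add: contracted_algebra_def basis_def)

lemma zero_mult_algebra [simp]: "0 \<otimes>\<^bsub>algebra\<^esub> g = 0" "g \<otimes>\<^bsub>algebra\<^esub> 0 = 0"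
  by (simp_all add: mult_algebra)

text \<open>Cancellation can shrink the support of \<open>f + g\<close>, but the summand at a key is
  additive in the coefficient and vanishes at coefficient 0, so the sums over keys still add
  up.\<close>

lemma add_mult_algebra:
  "(f + g) \<otimes>\<^bsub>algebra\<^esub> h = (f \<otimes>\<^bsub>algebra\<^esub> h) + (g \<otimes>\<^bsub>algebra\<^esub> h)"
  unfolding mult_algebra
  by (rule setsum_keys_plus_distrib) (simp_all add: distrib_right basis_add sum.distrib)

lemma mult_add_algebra:
  "h \<otimes>\<^bsub>algebra\<^esub> (f + g) = (h \<otimes>\<^bsub>algebra\<^esub> f) + (h \<otimes>\<^bsub>algebra\<^esub> g)"
  unfolding mult_algebra sum.distrib[symmetric]
  by (intro sum.cong refl setsum_keys_plus_distrib) (simp_all add: distrib_left basis_add)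

lemma mult_sum_algebra: "f \<otimes>\<^bsub>algebra\<^esub> (\<Sum>i\<in>J. g i) = (\<Sum>i\<in>J. f \<otimes>\<^bsub>algebra\<^esub> g i)"
  by (induction J rule: infinite_finite_induct) (simp_all add: mult_add_algebra)

lemma single_mult_single [simp]:
  "Poly_Mapping.single s a \<otimes>\<^bsub>algebra\<^esub> Poly_Mapping.single t b = basis (s \<otimes> t) (a * b)"
  by (simp add: mult_algebra)

lemma basis_mult_single [simp]:
  "t \<in> carrier S \<Longrightarrow> basis s a \<otimes>\<^bsub>algebra\<^esub> Poly_Mapping.single t b = basis (s \<otimes> t) (a * b)"
  by (simp add: basis_def)

lemma single_mult_basis [simp]:
  "s \<in> carrier S \<Longrightarrow> Poly_Mapping.single s a \<otimes>\<^bsub>algebra\<^esub> basis t b = basis (s \<otimes> t) (a * b)"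
  by (simp add: basis_def)

lemma single_in_algebra [simp]:
  "s \<in> carrier S - {z} \<Longrightarrow> Poly_Mapping.single s a \<in> carrier algebra"
  by (simp add: carrier_algebra)

lemma basis_in_algebra [simp]: "s \<in> carrier S \<Longrightarrow> basis s a \<in> carrier algebra"
  by (simp add: basis_def carrier_algebra)

lemma add_in_algebra [simp]:
  "f \<in> carrier algebra \<Longrightarrow> g \<in> carrier algebra \<Longrightarrow> f + g \<in> carrier algebra"
  unfolding carrier_algebra using keys_add[of f g] by blast

lemma sum_in_algebra [simp]:
  "(\<And>i. i \<in> J \<Longrightarrow> f i \<in> carrier algebra) \<Longrightarrow> (\<Sum>i\<in>J. f i) \<in> carrier algebra"
  by (induction J rule: infinite_finite_induct) (simp_all add: carrier_algebra[THEN eqset_imp_iff, of 0])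

lemma mult_in_algebra [simp]:
  "f \<in> carrier algebra \<Longrightarrow> g \<in> carrier algebra \<Longrightarrow> f \<otimes>\<^bsub>algebra\<^esub> g \<in> carrier algebra"
  unfolding mult_algebra
  by (intro sum_in_algebra basis_in_algebra m_closed) (auto simp: carrier_algebra)

lemma algebra_induct [consumes 1, case_names zero single add]:
  assumes "f \<in> carrier algebra" "P 0"
    "\<And>s c. s \<in> carrier S \<Longrightarrow> s \<noteq> z \<Longrightarrow> P (Poly_Mapping.single s c)"
    "\<And>f g. P f \<Longrightarrow> P g \<Longrightarrow> P (f + g)"
  shows "P f"
  using assms by (intro in_span_induct[of f "carrier S - {z}" P]) (auto simp: carrier_algebra)

text \<open>By additivity in each argument it suffices to take three basis vectors, where
  associativity is that of \<open>S\<close>.\<close>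

lemma mult_assoc_algebra:
  assumes "f \<in> carrier algebra" "g \<in> carrier algebra" "h \<in> carrier algebra"
  shows "f \<otimes>\<^bsub>algebra\<^esub> g \<otimes>\<^bsub>algebra\<^esub> h = f \<otimes>\<^bsub>algebra\<^esub> (g \<otimes>\<^bsub>algebra\<^esub> h)"
  using assms(1)
proof (induction rule: algebra_induct)
  case f: (single s a)
  from assms(2) show ?case
  proof (induction rule: algebra_induct)
    case g: (single t b)
    from assms(3) show ?case
      by (induction rule: algebra_induct) (use f g in \<open>simp_all add: mult_add_algebra m_assoc mult.assoc\<close>)
  qed (simp_all add: mult_add_algebra add_mult_algebra)
qed (simp_all add: add_mult_algebra)

lemma ring_algebra: "ring (algebra :: ('k::field, 'a \<Rightarrow>\<^sub>0 'k) module)"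
proof (rule ringI)
  show "abelian_group (algebra :: ('k, 'a \<Rightarrow>\<^sub>0 'k) module)"
  proof (rule abelian_groupI)
    fix f :: "'a \<Rightarrow>\<^sub>0 'k" assume "f \<in> carrier algebra"
    then show "\<exists>g\<in>carrier algebra. g \<oplus>\<^bsub>algebra\<^esub> f = \<zero>\<^bsub>algebra\<^esub>"
      by (intro bexI[of _ "- f"]) (auto simp: carrier_algebra)
  qed (simp_all add: ac_simps, simp add: carrier_algebra)
  show "Group.monoid (algebra :: ('k, 'a \<Rightarrow>\<^sub>0 'k) module)"
  proof (rule monoidI)
    fix f :: "'a \<Rightarrow>\<^sub>0 'k" assume f: "f \<in> carrier algebra"
    from f show "\<one>\<^bsub>algebra\<^esub> \<otimes>\<^bsub>algebra\<^esub> f = f"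
      by (induction rule: algebra_induct) (simp_all add: mult_add_algebra basis_def)
    from f show "f \<otimes>\<^bsub>algebra\<^esub> \<one>\<^bsub>algebra\<^esub> = f"
      by (induction rule: algebra_induct) (simp_all add: add_mult_algebra basis_def)
  qed (simp_all add: mult_assoc_algebra)
qed (simp_all add: add_mult_algebra mult_add_algebra)

lemma mult_single_algebra:
  "f \<otimes>\<^bsub>algebra\<^esub> Poly_Mapping.single t b = (\<Sum>s\<in>Poly_Mapping.keys f. basis (s \<otimes> t) (Poly_Mapping.lookup f s * b))"
  by (simp add: mult_algebra)

text \<open>Multiplying by one basis vector on each side acts on \<open>f\<close> term by term; this
  is the tool that isolates coefficients inside an ideal.\<close>

lemma sandwich_algebra:
  assumes "f \<in> carrier algebra" "e \<in> carrier S - {z}" "e' \<in> carrier S - {z}"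
  shows "Poly_Mapping.single e 1 \<otimes>\<^bsub>algebra\<^esub> (f \<otimes>\<^bsub>algebra\<^esub> Poly_Mapping.single e' 1) =
    (\<Sum>s\<in>Poly_Mapping.keys f. basis (e \<otimes> (s \<otimes> e')) (Poly_Mapping.lookup f s))"
  using assms by (auto simp: mult_single_algebra mult_sum_algebra carrier_algebra intro!: sum.cong)

end

subsection \<open>The inverse hull of a self-similar action\<close>

text \<open>\<open>res_mult\<close> is the cocycle rule that makes the extension to words an action
  of \<open>G\<close> as well.\<close>

locale self_similar_action = group G for G :: "'a monoid" (structure) +
  fixes X :: "'x set" and \<sigma> :: "'a \<Rightarrow> 'x \<Rightarrow> 'x" and \<rho> :: "'a \<Rightarrow> 'x \<Rightarrow> 'a"
  assumes act_closed [simp]: "g \<in> carrier G \<Longrightarrow> x \<in> X \<Longrightarrow> \<sigma> g x \<in> X"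
    and res_closed [simp]: "g \<in> carrier G \<Longrightarrow> x \<in> X \<Longrightarrow> \<rho> g x \<in> carrier G"
    and act_one [simp]: "x \<in> X \<Longrightarrow> \<sigma> \<one> x = x"
    and res_one [simp]: "x \<in> X \<Longrightarrow> \<rho> \<one> x = \<one>"
    and act_mult [simp]: "g \<in> carrier G \<Longrightarrow> h \<in> carrier G \<Longrightarrow> x \<in> X \<Longrightarrow> \<sigma> (g \<otimes> h) x = \<sigma> g (\<sigma> h x)"
    and res_mult [simp]:
      "g \<in> carrier G \<Longrightarrow> h \<in> carrier G \<Longrightarrow> x \<in> X \<Longrightarrow> \<rho> (g \<otimes> h) x = \<rho> g (\<sigma> h x) \<otimes> \<rho> h x"
begin

abbreviation wact (infixr "\<bullet>" 75) where "g \<bullet> w \<equiv> word_act \<sigma> \<rho> g w"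
abbreviation wres (infixl "\<restriction>" 75) where "g \<restriction> w \<equiv> word_res \<rho> g w"

lemma word_act_closed [simp]: "g \<in> carrier G \<Longrightarrow> w \<in> lists X \<Longrightarrow> g \<bullet> w \<in> lists X"
  by (induction w arbitrary: g) auto

lemma word_res_closed [simp]: "g \<in> carrier G \<Longrightarrow> w \<in> lists X \<Longrightarrow> g \<restriction> w \<in> carrier G"
  by (induction w arbitrary: g) auto

lemma length_word_act [simp]: "length (g \<bullet> w) = length w"
  by (induction w arbitrary: g) auto

lemma word_act_append [simp]: "g \<bullet> (u @ w) = g \<bullet> u @ (g \<restriction> u) \<bullet> w"
  by (induction u arbitrary: g) auto

lemma word_res_append [simp]: "g \<restriction> (u @ w) = (g \<restriction> u) \<restriction> w"
  by (induction u arbitrary: g) auto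

lemma word_act_one [simp]: "w \<in> lists X \<Longrightarrow> \<one> \<bullet> w = w"
  by (induction w) auto

lemma word_res_one [simp]: "w \<in> lists X \<Longrightarrow> \<one> \<restriction> w = \<one>"
  by (induction w) auto

lemma word_act_mult [simp]:
  "g \<in> carrier G \<Longrightarrow> h \<in> carrier G \<Longrightarrow> w \<in> lists X \<Longrightarrow> (g \<otimes> h) \<bullet> w = g \<bullet> (h \<bullet> w)"
  by (induction w arbitrary: g h) auto

lemma word_res_mult [simp]:
  "g \<in> carrier G \<Longrightarrow> h \<in> carrier G \<Longrightarrow> w \<in> lists X \<Longrightarrow>
   (g \<otimes> h) \<restriction> w = (g \<restriction> (h \<bullet> w)) \<otimes> (h \<restriction> w)"
  by (induction w arbitrary: g h) auto

lemma word_act_inv [simp]: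
  assumes "g \<in> carrier G" "w \<in> lists X"
  shows "g \<bullet> (inv g \<bullet> w) = w" "inv g \<bullet> (g \<bullet> w) = w"
  using assms by (simp_all flip: word_act_mult)

section \<open>The inverse hull as a monoid with zero\<close>

abbreviation "S \<equiv> inverse_hull G X \<sigma> \<rho>"

lemma None_in_hull [simp]: "None \<in> carrier S"
  by (simp add: inverse_hull_def)

lemma Some_in_hull [simp]:
  "Some (u, g, v) \<in> carrier S \<longleftrightarrow> u \<in> lists X \<and> g \<in> carrier G \<and> v \<in> lists X"
  by (auto simp: inverse_hull_def)

lemma mult_hull [simp]: "s \<otimes>\<^bsub>S\<^esub> t = hull_mult G \<sigma> \<rho> s t"
  by (simp add: inverse_hull_def)

lemma one_hull [simp]: "\<one>\<^bsub>S\<^esub> = Some ([], \<one>, [])"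
  by (simp add: inverse_hull_def)

lemma hull_mult_None [simp]: "hull_mult G \<sigma> \<rho> s None = None" "hull_mult G \<sigma> \<rho> None s = None"
  by (cases s; auto)+

lemma hull_cases [consumes 1, case_names zero nonzero]:
  assumes "s \<in> carrier S"
  obtains "s = None"
  | u g v where "s = Some (u, g, v)" "u \<in> lists X" "g \<in> carrier G" "v \<in> lists X"
  using assms by (cases s) auto

text \<open>The left action of the inverse hull by partial maps on the monoid of pairs
  \<open>(w, k)\<close>, that is, of the elements \<open>w k\<close> of \<open>X\<^sup>*G\<close>.\<close>

fun hull_act :: "('x list \<times> 'a \<times> 'x list) option \<Rightarrow> 'x list \<times> 'a \<Rightarrow> ('x list \<times> 'a) option" where
  "hull_act (Some (u, g, v)) (w, k) =
    (if prefix v w then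
       Some (u @ g \<bullet> drop (length v) w, (g \<restriction> drop (length v) w) \<otimes> k) else None)"
| "hull_act None _ = None"

lemma hull_mult_closed:
  assumes "s \<in> carrier S" "t \<in> carrier S"
  shows "hull_mult G \<sigma> \<rho> s t \<in> carrier S"
proof -
  have [simp]: "drop n w \<in> lists X" if "w \<in> lists X" for n w
    using that by (auto dest: in_set_dropD)
  show ?thesis
    using assms(1)
  proof (cases rule: hull_cases)
    case s: (nonzero u g v)
    from assms(2) show ?thesis
    proof (cases rule: hull_cases)
      case t: (nonzero w h z)
      with s show ?thesis
        by (auto simp: Let_def in_lists_conv_set[symmetric])
    qed auto
  qed auto
qed

text \<open>Multiplication in the hull is composition of partial maps. The delicate case is
  \<open>v = w @ v'\<close>: the composite is defined at \<open>z @ x'\<close> exactly when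
  \<open>v'\<close> is a prefix of \<open>h \<bullet> x'\<close>, and since the action is by
  prefix-preserving bijections this says that \<open>inv h \<bullet> v'\<close> is a prefix of
  \<open>x'\<close>.\<close>

lemma hull_act_mult:
  assumes "s \<in> carrier S" "t \<in> carrier S" "x \<in> lists X" "k \<in> carrier G"
  shows "hull_act (hull_mult G \<sigma> \<rho> s t) (x, k) = Option.bind (hull_act t (x, k)) (hull_act s)"
  using assms(1)
proof (cases rule: hull_cases)
  case s: (nonzero u g v)
  from assms(2) show ?thesis
  proof (cases rule: hull_cases)
    case t: (nonzero w h z)
    show ?thesis
    proof (cases "prefix v w")
      case True
      then obtain w' where w': "w = v @ w'" by (auto simp: prefix_def)
      show ?thesis
      proof (cases "prefix z x")
        case True
        then obtain x' where "x = z @ x'" by (auto simp: prefix_def)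
        then show ?thesis using s t w' assms by (simp add: m_assoc)
      qed (use s t w' in simp)
    next
      case nv: False
      show ?thesis
      proof (cases "prefix w v")
        case True
        then obtain v' where v': "v = w @ v'" by (auto simp: prefix_def)
        let ?t = "inv h \<bullet> v'"
        have st: "hull_mult G \<sigma> \<rho> s t = Some (u, g \<otimes> (h \<restriction> ?t), z @ ?t)"
          using nv s t v' by (simp add: Let_def)
        show ?thesis
        proof (cases "prefix z x")
          case True
          then obtain x' where x': "x = z @ x'" by (auto simp: prefix_def)
          have X: "v' \<in> lists X" "x' \<in> lists X" using s v' x' assms by auto
          show ?thesis
          proof (cases "prefix ?t x'")
            case True
            then obtain y where "x' = ?t @ y" by (auto simp: prefix_def)
            then show ?thesis unfolding st using s t v' X x' assms
              by (simp add: m_assoc)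
          next
            case False
            have "\<not> prefix v' (h \<bullet> x')"
            proof
              assume "prefix v' (h \<bullet> x')"
              then obtain y where y: "h \<bullet> x' = v' @ y" by (auto simp: prefix_def)
              then have "x' = inv h \<bullet> (v' @ y)" using t X by (metis word_act_inv(2))
              then show False using False by simp
            qed
            then show ?thesis using False unfolding st using s t v' x'
              by simp
          qed
        next
          case False
          then have "\<not> prefix (z @ ?t) x" by (auto dest: append_prefixD)
          then show ?thesis unfolding st using s t False by simp
        qed
      next
        case False
        \<comment> \<open>Two prefixes of one word are comparable, so \<open>v\<close> and
          \<open>w\<close> have no common extension.\<close>
        have "\<not> prefix v (w @ y)" for y
          using nv False by (metis prefix_append prefix_def prefix_same_cases)
        then show ?thesis using nv False s t by simp
      qed
    qed
  qed simp
qed (cases "hull_act t (x, k)"; auto)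

lemma hull_act_closed:
  assumes "s \<in> carrier S" "x \<in> lists X" "k \<in> carrier G" "hull_act s (x, k) = Some (y, l)"
  shows "y \<in> lists X \<and> l \<in> carrier G"
  using assms(1)
proof (cases rule: hull_cases)
  case (nonzero u g v)
  with assms obtain w where "x = v @ w" by (auto simp: prefix_def split: if_splits)
  then have "w \<in> lists X" using assms(2) by simp
  moreover have "y = u @ g \<bullet> w" "l = (g \<restriction> w) \<otimes> k"
    using assms(4) nonzero \<open>x = v @ w\<close> by simp_all
  ultimately show ?thesis using nonzero assms(3) by simp
qed (use assms in simp)

text \<open>The map of \<open>u g v\<^sup>*\<close> is defined on the extensions of
  \<open>v\<close>, so the tests at \<open>v\<close> and at \<open>z\<close> make each a prefix of
  the other; the value at \<open>v\<close> is then \<open>(u, g)\<close>.\<close>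

lemma hull_act_faithful:
  assumes "s \<in> carrier S" "t \<in> carrier S"
    and eq: "\<And>x. x \<in> lists X \<Longrightarrow> hull_act s (x, \<one>) = hull_act t (x, \<one>)"
  shows "s = t"
  using assms(1)
proof (cases rule: hull_cases)
  case s: (nonzero u g v)
  show ?thesis
    using assms(2)
  proof (cases rule: hull_cases)
    case t: (nonzero w h z)
    have "prefix z v"
      using eq[of v] s t by (auto split: if_splits)
    moreover have "prefix v z"
      using eq[of z] s t by (auto split: if_splits)
    ultimately have "v = z" by (simp add: prefix_order.eq_iff)
    then show ?thesis using eq[of v] s t by simp
  qed (use s eq[of v] in simp)
next
  case zero
  show ?thesis
    using assms(2)
  proof (cases rule: hull_cases)
    case (nonzero w h z)
    then show ?thesis using zero eq[of z] by simp
  qed (use zero in simp)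
qed

text \<open>Composition of partial maps is associative and the representation is faithful. This
  replaces a comparison of prefixes among all three factors.\<close>

lemma hull_mult_assoc:
  assumes "s \<in> carrier S" "t \<in> carrier S" "r \<in> carrier S"
  shows "hull_mult G \<sigma> \<rho> (hull_mult G \<sigma> \<rho> s t) r = hull_mult G \<sigma> \<rho> s (hull_mult G \<sigma> \<rho> t r)"
proof (rule hull_act_faithful)
  fix x assume x: "x \<in> lists X"
  show "hull_act (hull_mult G \<sigma> \<rho> (hull_mult G \<sigma> \<rho> s t) r) (x, \<one>) =
        hull_act (hull_mult G \<sigma> \<rho> s (hull_mult G \<sigma> \<rho> t r)) (x, \<one>)"
  proof (cases "hull_act r (x, \<one>)")
    case (Some yk)
    then show ?thesis using assms x hull_act_closed[OF assms(3) x one_closed]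
      by (cases yk) (simp add: hull_act_mult hull_mult_closed)
  qed (use assms x in \<open>simp add: hull_act_mult hull_mult_closed\<close>)
qed (use assms in \<open>simp_all add: hull_mult_closed\<close>)

lemma monoid_hull: "Group.monoid S"
proof (rule monoidI)
  fix s assume s: "s \<in> carrier S"
  show "\<one>\<^bsub>S\<^esub> \<otimes>\<^bsub>S\<^esub> s = s"
    using s by (cases rule: hull_cases) auto
  show "s \<otimes>\<^bsub>S\<^esub> \<one>\<^bsub>S\<^esub> = s"
    using s by (cases rule: hull_cases) (auto simp: Let_def)
qed (simp_all add: hull_mult_closed hull_mult_assoc)

sublocale A: monoid_with_zero S None
proof (intro monoid_with_zero.intro monoid_hull)
  show "monoid_with_zero_axioms S None"
    by unfold_locales auto
qed

section \<open>The action on words alone and the kernel of its linear extension\<close>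

definition hull_word_act :: "('x list \<times> 'a \<times> 'x list) option \<Rightarrow> 'x list \<Rightarrow> 'x list option"
  where "hull_word_act s w = map_option fst (hull_act s (w, \<one>))"

lemma hull_word_act_Some:
  "hull_word_act (Some (u, g, v)) w =
    (if prefix v w then Some (u @ word_act \<sigma> \<rho> g (drop (length v) w)) else None)"
  by (simp add: hull_word_act_def)

lemma hull_word_act_None [simp]: "hull_word_act None w = None"
  by (simp add: hull_word_act_def)

lemma fst_hull_act: "map_option fst (hull_act s (w, k)) = hull_word_act s w"
  unfolding hull_word_act_def by (cases "(s, w, k)" rule: hull_act.cases) auto

lemma hull_word_act_mult:
  assumes "s \<in> carrier S" "t \<in> carrier S" "w \<in> lists X"
  shows "hull_word_act (hull_mult G \<sigma> \<rho> s t) w = Option.bind (hull_word_act t w) (hull_word_act s)"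
  unfolding hull_word_act_def[of _ w] hull_act_mult[OF assms one_closed]
  by (cases "hull_act t (w, \<one>)") (auto simp: fst_hull_act)

lemma hull_word_act_closed:
  "s \<in> carrier S \<Longrightarrow> w \<in> lists X \<Longrightarrow> hull_word_act s w = Some w' \<Longrightarrow> w' \<in> lists X"
  unfolding hull_word_act_def using hull_act_closed[OF _ _ one_closed] by fastforce

text \<open>On its domain \<open>u g v\<^sup>*\<close> strips \<open>v\<close>, applies the
  bijection \<open>g\<close> and attaches \<open>u\<close>. Injectivity makes left multiplication by
  a basis vector move rows of the matrix without adding them up.\<close>

lemma hull_word_act_inj:
  assumes s: "s \<in> carrier S" and w: "w \<in> lists X" "w' \<in> lists X"
    and eq: "hull_word_act s w = Some y" "hull_word_act s w' = Some y"
  shows "w = w'"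
  using s
proof (cases rule: hull_cases)
  case (nonzero u g v)
  then obtain d d' where d: "w = v @ d" "w' = v @ d'"
    using eq by (auto simp: hull_word_act_Some prefix_def split: if_splits)
  with nonzero eq have "word_act \<sigma> \<rho> g d = word_act \<sigma> \<rho> g d'"
    by (auto simp: hull_word_act_Some)
  moreover have "d \<in> lists X" "d' \<in> lists X" using d w by simp_all
  ultimately have "d = d'" using nonzero(3) by (metis word_act_inv(2))
  then show ?thesis using d by simp
qed (use eq in simp)

text \<open>The \<open>(w', w)\<close> entry of the matrix by which \<open>f\<close> acts on the free vector space over the words.\<close>

definition word_coeff ::
  "(('x list \<times> 'a \<times> 'x list) option \<Rightarrow>\<^sub>0 'k::field) \<Rightarrow> 'x list \<Rightarrow> 'x list \<Rightarrow> 'k"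
  where "word_coeff f w w' =
    (\<Sum>s\<in>Poly_Mapping.keys f. if hull_word_act s w = Some w' then Poly_Mapping.lookup f s else 0)"

lemma word_coeff_0 [simp]: "word_coeff 0 w w' = 0"
  by (simp add: word_coeff_def)

lemma word_coeff_add: "word_coeff (f + g) w w' = word_coeff f w w' + word_coeff g w w'"
  unfolding word_coeff_def by (rule setsum_keys_plus_distrib) simp_all

lemma word_coeff_sum: "word_coeff (\<Sum>i\<in>J. f i) w w' = (\<Sum>i\<in>J. word_coeff (f i) w w')"
  by (induction J rule: infinite_finite_induct) (simp_all add: word_coeff_add)

lemma word_coeff_minus: "word_coeff (- f) w w' = - word_coeff f w w'"
  using word_coeff_add[of f "- f" w w'] by (simp add: eq_neg_iff_add_eq_0 add.commute)

lemma word_coeff_single: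
  "word_coeff (Poly_Mapping.single s c) w w' = (if hull_word_act s w = Some w' then c else 0)"
  by (simp add: word_coeff_def)

lemma word_coeff_basis:
  "word_coeff (A.basis s c) w w' = (if hull_word_act s w = Some w' then c else 0)"
  by (simp add: A.basis_def word_coeff_single)

definition word_kernel :: "(('x list \<times> 'a \<times> 'x list) option \<Rightarrow>\<^sub>0 'k::field) set"
  where "word_kernel = {f \<in> carrier A.algebra. \<forall>w\<in>lists X. \<forall>w'\<in>lists X. word_coeff f w w' = 0}"

text \<open>Since the product acts as \<open>t\<close> followed by \<open>f\<close>, its column at
  \<open>w\<close> is a multiple of one column of \<open>f\<close>, or zero.\<close>

lemma word_coeff_mult_single:
  assumes "f \<in> carrier A.algebra" and t: "t \<in> carrier S" and w: "w \<in> lists X"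
  shows "word_coeff (f \<otimes>\<^bsub>A.algebra\<^esub> Poly_Mapping.single t b) w w' =
    (case hull_word_act t w of None \<Rightarrow> 0 | Some y \<Rightarrow> word_coeff f y w' * b)"
  using assms(1)
proof (induction rule: A.algebra_induct)
  case (single s a)
  then show ?case using t w
    by (auto simp: word_coeff_basis word_coeff_single hull_word_act_mult split: option.split)
qed (auto simp: A.add_mult_algebra word_coeff_add distrib_right split: option.split)

text \<open>By injectivity \<open>y\<close> is the only word that \<open>s\<close> carries to
  \<open>w'\<close>, so only the row of \<open>f\<close> at \<open>y\<close> contributes.\<close>

lemma word_coeff_single_mult:
  assumes "f \<in> carrier A.algebra" and s: "s \<in> carrier S" and w: "w \<in> lists X"
    and y: "y \<in> lists X" "hull_word_act s y = Some w'"
  shows "word_coeff (Poly_Mapping.single s a \<otimes>\<^bsub>A.algebra\<^esub> f) w w' = a * word_coeff f w y"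
  using assms(1)
proof (induction rule: A.algebra_induct)
  case (single t b)
  have "hull_word_act (hull_mult G \<sigma> \<rho> s t) w = Some w' \<longleftrightarrow> hull_word_act t w = Some y"
  proof (cases "hull_word_act t w")
    case (Some y')
    then have "hull_word_act s y' = Some w' \<longleftrightarrow> y' = y"
      using hull_word_act_closed[OF single(1) w Some] hull_word_act_inj[OF s _ y(1) _ y(2)] y(2) by blast
    then show ?thesis using Some by (simp add: hull_word_act_mult[OF s single(1) w])
  qed (simp add: hull_word_act_mult[OF s single(1) w])
  then show ?case by (simp add: word_coeff_basis word_coeff_single)
qed (auto simp: A.mult_add_algebra word_coeff_add distrib_left)

lemma word_coeff_single_mult_0:
  assumes "f \<in> carrier A.algebra" and s: "s \<in> carrier S" and w: "w \<in> lists X"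
    and y: "\<And>y. y \<in> lists X \<Longrightarrow> hull_word_act s y \<noteq> Some w'"
  shows "word_coeff (Poly_Mapping.single s a \<otimes>\<^bsub>A.algebra\<^esub> f) w w' = 0"
  using assms(1)
proof (induction rule: A.algebra_induct)
  case (single t b)
  have "hull_word_act (hull_mult G \<sigma> \<rho> s t) w \<noteq> Some w'"
    using hull_word_act_closed[OF single(1) w] y
    unfolding hull_word_act_mult[OF s single(1) w] bind_eq_Some_conv by blast
  then show ?case by (simp add: word_coeff_basis)
qed (auto simp: A.mult_add_algebra word_coeff_add)

lemma zero_in_word_kernel: "0 \<in> word_kernel"
  by (simp add: word_kernel_def A.carrier_algebra)

lemma add_in_word_kernel: "f \<in> word_kernel \<Longrightarrow> g \<in> word_kernel \<Longrightarrow> f + g \<in> word_kernel"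
  by (simp add: word_kernel_def word_coeff_add)

lemma word_kernel_mult:
  assumes "f \<in> word_kernel" "g \<in> carrier A.algebra"
  shows "f \<otimes>\<^bsub>A.algebra\<^esub> g \<in> word_kernel"
  using assms(2)
proof (induction rule: A.algebra_induct)
  case (single t b)
  have f: "f \<in> carrier A.algebra" using assms(1) by (simp add: word_kernel_def)
  have "word_coeff (f \<otimes>\<^bsub>A.algebra\<^esub> Poly_Mapping.single t b) w w' = 0"
    if "w \<in> lists X" "w' \<in> lists X" for w w'
  proof (cases "hull_word_act t w")
    case (Some y)
    then have "word_coeff f y w' = 0"
      using assms(1) hull_word_act_closed[OF single(1) that(1)] that unfolding word_kernel_def by blast
    then show ?thesis using Some by (simp add: word_coeff_mult_single[OF f single(1) that(1)])
  qed (simp add: word_coeff_mult_single[OF f single(1) that(1)])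
  moreover have "f \<otimes>\<^bsub>A.algebra\<^esub> Poly_Mapping.single t b \<in> carrier A.algebra"
    using f single by (intro A.mult_in_algebra A.single_in_algebra) simp_all
  ultimately show ?case unfolding word_kernel_def by blast
qed (simp_all add: zero_in_word_kernel add_in_word_kernel A.mult_add_algebra)

lemma mult_word_kernel:
  assumes "f \<in> word_kernel" "g \<in> carrier A.algebra"
  shows "g \<otimes>\<^bsub>A.algebra\<^esub> f \<in> word_kernel"
  using assms(2)
proof (induction rule: A.algebra_induct)
  case (single s a)
  have f: "f \<in> carrier A.algebra" using assms(1) by (simp add: word_kernel_def)
  have "word_coeff (Poly_Mapping.single s a \<otimes>\<^bsub>A.algebra\<^esub> f) w w' = 0"
    if w: "w \<in> lists X" "w' \<in> lists X" for w w'
  proof (cases "\<exists>y\<in>lists X. hull_word_act s y = Some w'")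
    case True
    then obtain y where y: "y \<in> lists X" "hull_word_act s y = Some w'" by blast
    then have "word_coeff f w y = 0" using assms(1) w unfolding word_kernel_def by blast
    then show ?thesis by (simp add: word_coeff_single_mult[OF f single(1) w(1) y])
  next
    case False
    then show ?thesis by (intro word_coeff_single_mult_0[OF f single(1) w(1)]) blast
  qed
  moreover have "Poly_Mapping.single s a \<otimes>\<^bsub>A.algebra\<^esub> f \<in> carrier A.algebra"
    using f single by (intro A.mult_in_algebra A.single_in_algebra) simp_all
  ultimately show ?case unfolding word_kernel_def by blast
qed (simp_all add: zero_in_word_kernel add_in_word_kernel A.add_mult_algebra)

lemma ideal_word_kernel: "ideal (word_kernel :: (_ \<Rightarrow>\<^sub>0 'k::field) set) A.algebra"
proof (rule idealI[OF A.ring_algebra])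
  interpret R: ring "A.algebra :: ('k, _) module" by (rule A.ring_algebra)
  show "subgroup word_kernel (add_monoid (A.algebra :: ('k, _) module))"
  proof (rule group.subgroupI[OF R.a_group])
    fix f :: "_ \<Rightarrow>\<^sub>0 'k" assume f: "f \<in> word_kernel"
    then have fA: "f \<in> carrier A.algebra" by (simp add: word_kernel_def)
    then have mA: "- f \<in> carrier A.algebra" by (auto simp: A.carrier_algebra)
    have "\<ominus>\<^bsub>A.algebra\<^esub> f = - f" by (rule R.minus_equality) (use fA mA in simp_all)
    then show "inv\<^bsub>add_monoid A.algebra\<^esub> f \<in> word_kernel"
      using f mA by (simp add: a_inv_def word_kernel_def word_coeff_minus)
  qed (use zero_in_word_kernel add_in_word_kernel in \<open>auto simp: word_kernel_def\<close>)
qed (simp_all add: word_kernel_mult mult_word_kernel)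

text \<open>Scaling by \<open>c\<close> is left multiplication by \<open>c\<close> times the unit,
  so closure under scalars follows from the ideal property.\<close>

lemma smult_word_kernel:
  assumes "f \<in> word_kernel"
  shows "c \<odot>\<^bsub>A.algebra\<^esub> f \<in> word_kernel"
proof -
  have lookup: "Poly_Mapping.lookup (Poly_Mapping.map ((*) c) h) k = c * Poly_Mapping.lookup h k"
    for h :: "(_ \<Rightarrow>\<^sub>0 'k::field)" and c k
    by (simp add: Poly_Mapping.map.rep_eq when_def)
  have "f \<in> carrier A.algebra" using assms by (simp add: word_kernel_def)
  then have "c \<odot>\<^bsub>A.algebra\<^esub> f = Poly_Mapping.single \<one>\<^bsub>S\<^esub> c \<otimes>\<^bsub>A.algebra\<^esub> f"
  proof (induction rule: A.algebra_induct)
    case (single s a)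
    then show ?case
      by (cases rule: hull_cases[OF single(1)])
        (auto intro!: poly_mapping_eqI simp: A.basis_def lookup lookup_single when_def)
  next
    case (add f g)
    have "c \<odot>\<^bsub>A.algebra\<^esub> (f + g) = (c \<odot>\<^bsub>A.algebra\<^esub> f) + (c \<odot>\<^bsub>A.algebra\<^esub> g)"
      by (auto intro!: poly_mapping_eqI simp: lookup lookup_add distrib_left)
    then show ?case using add by (simp add: A.mult_add_algebra)
  qed (auto intro!: poly_mapping_eqI simp: lookup)
  then show ?thesis using assms by (simp add: mult_word_kernel)
qed

text \<open>The kernel is proper, since the unit has entry 1 at the empty word.\<close>

lemma not_simple_if_word_kernel:
  assumes "f \<in> (word_kernel :: (_ \<Rightarrow>\<^sub>0 'k::field) set)" "f \<noteq> 0"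
  shows "\<not> simple_algebra (A.algebra :: ('k, _) module)"
proof
  let ?R = "A.algebra :: ('k, _) module" and ?K = "word_kernel :: (_ \<Rightarrow>\<^sub>0 'k) set"
  assume "simple_algebra ?R"
  then have "ideal ?K ?R \<and> (\<forall>c. \<forall>f\<in>?K. c \<odot>\<^bsub>?R\<^esub> f \<in> ?K) \<longrightarrow> ?K = {\<zero>\<^bsub>?R\<^esub>} \<or> ?K = carrier ?R"
    unfolding simple_algebra_def by (elim conjE) (erule spec)
  then have "?K = {\<zero>\<^bsub>?R\<^esub>} \<or> ?K = carrier ?R"
    by (rule mp) (intro conjI allI ballI ideal_word_kernel smult_word_kernel)
  moreover have "?K \<noteq> {\<zero>\<^bsub>?R\<^esub>}"
    using assms unfolding A.ops_algebra by blast
  ultimately have "?K = carrier ?R" by blast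
  moreover have "Poly_Mapping.single \<one>\<^bsub>S\<^esub> 1 \<in> carrier ?R"
    by (rule A.single_in_algebra) simp
  ultimately have one: "Poly_Mapping.single \<one>\<^bsub>S\<^esub> 1 \<in> ?K" by (simp only:)
  have "word_coeff (Poly_Mapping.single \<one>\<^bsub>S\<^esub> (1 :: 'k)) [] [] = 0"
    using one lists.Nil unfolding word_kernel_def by blast
  then show False by (simp add: word_coeff_single hull_word_act_Some)
qed

end

subsection \<open>Affine lines in \<open>C\<^sub>p \<times> C\<^sub>p\<close>\<close>

text \<open>\<open>\<theta>\<close> is the coefficient vector of a linear functional on
  \<open>C_p x C_p\<close>; for \<open>\<theta>\<close> in \<open>lines p\<close> its level sets are
  the affine lines of one direction.\<close>

definition val :: "nat \<Rightarrow> int \<times> int \<Rightarrow> int \<times> int \<Rightarrow> int"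
  where "val p \<theta> v = (fst \<theta> * fst v + snd \<theta> * snd v) mod int p"

text \<open>Normalised representatives of the non-zero linear functionals on \<open>C\<^sub>p \<times> C\<^sub>p\<close>.\<close>

definition lines :: "nat \<Rightarrow> (int \<times> int) set"
  where "lines p = insert (0, 1) (Pair 1 ` {0..<int p})"

lemma val_eq_iff:
  "val p \<theta> v = val p \<theta> w \<longleftrightarrow>
    int p dvd fst \<theta> * (fst v - fst w) + snd \<theta> * (snd v - snd w)"
  unfolding val_def mod_eq_dvd_iff by (simp add: algebra_simps)

lemma residue_eqI:
  fixes a b m :: int
  assumes "a \<in> {0..<m}" "b \<in> {0..<m}" "m dvd a - b"
  shows "a = b"
  using assms by (metis atLeastLessThan_iff mod_eq_dvd_iff mod_pos_pos_trivial)

text \<open>At the non-zero difference \<open>(a, b)\<close> exactly one normalised functional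
  vanishes: \<open>(0, 1)\<close> if \<open>p\<close> divides \<open>b\<close>, and otherwise
  \<open>(1, t)\<close> with \<open>t = - a / b\<close> modulo \<open>p\<close>.\<close>

lemma card_lines_through:
  assumes p: "prime p" and vw: "v \<in> {0..<int p} \<times> {0..<int p}" "w \<in> {0..<int p} \<times> {0..<int p}"
    and "v \<noteq> w"
  shows "card {\<theta> \<in> lines p. val p \<theta> v = val p \<theta> w} = 1"
proof -
  define a b where "a = fst v - fst w" and "b = snd v - snd w"
  have mem: "fst v \<in> {0..<int p}" "fst w \<in> {0..<int p}" "snd v \<in> {0..<int p}" "snd w \<in> {0..<int p}"
    using vw by (auto simp: mem_Times_iff)
  have iff: "val p \<theta> v = val p \<theta> w \<longleftrightarrow> int p dvd fst \<theta> * a + snd \<theta> * b" for \<theta>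
    by (simp add: val_eq_iff a_def b_def)
  show ?thesis
  proof (cases "int p dvd b")
    case True
    then have "snd v = snd w" using mem residue_eqI unfolding b_def by blast
    then have "\<not> int p dvd a"
      using mem residue_eqI \<open>v \<noteq> w\<close> unfolding a_def by (metis prod.expand)
    then have "{\<theta> \<in> lines p. val p \<theta> v = val p \<theta> w} = {(0, 1)}"
      using True by (auto simp: iff lines_def dvd_add_left_iff)
    then show ?thesis by simp
  next
    case False
    have pp: "prime (int p)" using p by simp
    then have "coprime b (int p)" using False by (metis coprime_commute prime_imp_coprime)
    then obtain c where c: "[b * c = 1] (mod int p)" using cong_solve_coprime_int by blast
    define t where "t = (- a * c) mod int p"
    have t: "t \<in> {0..<int p}" using p prime_gt_0_nat by (simp add: t_def)
    have "[a + t * b = a + (- a * c) * b] (mod int p)"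
      unfolding t_def by (intro cong_add cong_mult cong_refl) simp
    also have "a + (- a * c) * b = a - a * (b * c)" by (simp add: algebra_simps)
    also have "[a - a * (b * c) = a - a * 1] (mod int p)"
      by (intro cong_diff cong_mult cong_refl c)
    finally have dvd: "int p dvd a + t * b" by (simp add: cong_0_iff)
    have "t' = t" if "t' \<in> {0..<int p}" "int p dvd a + t' * b" for t'
    proof -
      have "int p dvd (a + t' * b) - (a + t * b)" using that dvd by (intro dvd_diff)
      then have "int p dvd (t' - t) * b" by (simp add: algebra_simps)
      then have "int p dvd t' - t" using False pp prime_dvd_mult_iff by blast
      then show ?thesis using residue_eqI t that by blast
    qed
    then have uniq: "\<theta> = (1, t)" if "\<theta> \<in> lines p" "val p \<theta> v = val p \<theta> w" for \<theta>
      using that False unfolding iff lines_def by auto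
    have "(1, t) \<in> {\<theta> \<in> lines p. val p \<theta> v = val p \<theta> w}"
      using t dvd unfolding iff lines_def by simp
    then have "{\<theta> \<in> lines p. val p \<theta> v = val p \<theta> w} = {(1, t)}"
      using uniq by blast
    then show ?thesis by simp
  qed
qed

text \<open>Every point other than \<open>w\<close> lies on exactly one of the \<open>p + 1\<close> lines through \<open>w\<close>.\<close>

lemma line_sums:
  fixes d :: "int \<times> int \<Rightarrow> 'k::comm_ring_1"
  defines "V \<equiv> \<lambda>p. {0..<int p} \<times> {0..<int p}"
  assumes p: "prime p" and w: "w \<in> V p"
    and zero: "\<And>\<theta> r. \<theta> \<in> lines p \<Longrightarrow> r \<in> {0..<int p} \<Longrightarrow> (\<Sum>v | v \<in> V p \<and> val p \<theta> v = r. d v) = 0"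
  shows "of_nat p * d w = 0"
proof -
  have fin [simp]: "finite (V p)" "finite (lines p)" by (simp_all add: V_def lines_def)
  have pos: "0 < int p" using p prime_gt_0_nat by simp
  have val: "val p \<theta> v \<in> {0..<int p}" for \<theta> v using pos by (simp add: val_def)
  have "card (lines p) = Suc (card (Pair (1::int) ` {0..<int p}))"
    unfolding lines_def by (rule card_insert_disjoint) auto
  also have "\<dots> = p + 1" by (simp add: card_image inj_on_def)
  finally have card: "card (lines p) = p + 1" .
  \<comment> \<open>The level sets of any one functional partition the plane; \<open>(0, 1)\<close>
    serves here.\<close>
  have all: "(\<Sum>v\<in>V p. d v) = 0"
  proof -
    have "(\<Sum>v\<in>V p. d v) = (\<Sum>r\<in>{0..<int p}. \<Sum>v | v \<in> V p \<and> val p (0, 1) v = r. d v)"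
      by (rule sum.group[symmetric]) (use val in auto)
    also have "\<dots> = 0" by (intro sum.neutral ballI zero) (auto simp: lines_def)
    finally show ?thesis .
  qed
  have count: "card {\<theta> \<in> lines p. val p \<theta> v = val p \<theta> w} = (if v = w then p + 1 else 1)"
    if "v \<in> V p" for v
    using card_lines_through[OF p] that w card by (simp add: V_def)
  \<comment> \<open>The zero sums along the lines through \<open>w\<close> are added. Exchanging the
    sums counts each point by the number of these lines that contain it: \<open>p + 1\<close> for
    \<open>w\<close> and 1 for any other point.\<close>
  have "0 = (\<Sum>\<theta>\<in>lines p. \<Sum>v | v \<in> V p \<and> val p \<theta> v = val p \<theta> w. d v)"
    by (intro sum.neutral[symmetric] ballI zero val)
  also have "\<dots> = (\<Sum>\<theta>\<in>lines p. \<Sum>v\<in>V p. if val p \<theta> v = val p \<theta> w then d v else 0)"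
    by (intro sum.cong refl sum.inter_filter) simp
  also have "\<dots> = (\<Sum>v\<in>V p. \<Sum>\<theta>\<in>lines p. if val p \<theta> v = val p \<theta> w then d v else 0)"
    by (rule sum.swap)
  also have "\<dots> = (\<Sum>v\<in>V p. of_nat (card {\<theta> \<in> lines p. val p \<theta> v = val p \<theta> w}) * d v)"
    by (subst sum.inter_filter[symmetric]) simp_all
  \<comment> \<open>Splitting \<open>p + 1\<close> leaves the total sum, which is zero, and
    \<open>p\<close> times the term at \<open>w\<close>.\<close>
  also have "\<dots> = (\<Sum>v\<in>V p. d v + (if v = w then of_nat p * d v else 0))"
    by (intro sum.cong refl) (simp add: count distrib_right)
  also have "\<dots> = of_nat p * d w"
    using w by (simp add: sum.distrib all)
  finally show ?thesis by simp
qed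

subsection \<open>Subgroups of prime index\<close>

text \<open>Lagrange's theorem in the quotient by \<open>H\<close>. For infinite index the
  cardinality is 0 and the power is the identity.\<close>

lemma (in comm_group) pow_index_in_subgroup:
  assumes H: "subgroup H G" and x: "x \<in> carrier G"
  shows "x [^] card (lcosets H) \<in> H"
proof -
  interpret H: normal H G using H by (rule subgroup_imp_normal)
  interpret Q: group "G Mod H" by (rule H.factorgroup_is_group)
  have "order (G Mod H) = card (lcosets H)"
    using H.coset_eq by (simp add: order_def FactGroup_def RCOSETS_def LCOSETS_def)
  then have "(H #> x) [^]\<^bsub>G Mod H\<^esub> card (lcosets H) = H"
    using Q.pow_order_eq_1[of "H #> x"] hom_in_carrier[OF H.r_coset_hom_Mod x] by (simp add: FactGroup_def)
  then have "H #> (x [^] card (lcosets H)) = H"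
    using hom_nat_pow[OF H.r_coset_hom_Mod x is_group Q.is_group] by simp
  then show ?thesis using coset_join1 H x by blast
qed

text \<open>If \<open>C\<close> is the coset of \<open>k\<close>, commutativity cancels
  \<open>k\<close>, so every coset has the same stabiliser \<open>H\<close>.\<close>

lemma (in comm_group) lcos_lcoset_eq_iff:
  assumes H: "subgroup H G" and C: "C \<in> lcosets H" and g: "g \<in> carrier G" "h \<in> carrier G"
  shows "g <#\<^bsub>G\<^esub> C = h <#\<^bsub>G\<^esub> C \<longleftrightarrow> inv g \<otimes> h \<in> H"
proof -
  from C obtain k where k: "k \<in> carrier G" "C = k <#\<^bsub>G\<^esub> H" by (auto simp: LCOSETS_def)
  have C_eq: "x <#\<^bsub>G\<^esub> C = (x \<otimes> k) <#\<^bsub>G\<^esub> H" if "x \<in> carrier G" for x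
    using k that H by (simp add: lcos_m_assoc subgroup.subset)
  have "inv (g \<otimes> k) \<otimes> (h \<otimes> k) = inv g \<otimes> h"
    using k g by (simp add: inv_mult m_ac)
  moreover have "(g \<otimes> k) <#\<^bsub>G\<^esub> H = (h \<otimes> k) <#\<^bsub>G\<^esub> H \<longleftrightarrow> inv (g \<otimes> k) \<otimes> (h \<otimes> k) \<in> H"
  proof
    assume eq: "(g \<otimes> k) <#\<^bsub>G\<^esub> H = (h \<otimes> k) <#\<^bsub>G\<^esub> H"
    have "h \<otimes> k \<in> (h \<otimes> k) <#\<^bsub>G\<^esub> H" using k g H by (intro lcos_self) simp_all
    then have "h \<otimes> k \<in> (g \<otimes> k) <#\<^bsub>G\<^esub> H" using eq by simp
    then show "inv (g \<otimes> k) \<otimes> (h \<otimes> k) \<in> H"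
      using subgroup.lcos_module_imp[OF H is_group] k g by simp
  next
    assume "inv (g \<otimes> k) \<otimes> (h \<otimes> k) \<in> H"
    then have "h \<otimes> k \<in> (g \<otimes> k) <#\<^bsub>G\<^esub> H"
      using subgroup.lcos_module_rev[OF H is_group] k g by simp
    then show "(g \<otimes> k) <#\<^bsub>G\<^esub> H = (h \<otimes> k) <#\<^bsub>G\<^esub> H"
      using k g H by (intro l_repr_independence) simp_all
  qed
  ultimately show ?thesis using g by (simp add: C_eq)
qed

text \<open>The fibre is empty or a coset of \<open>\<iota>\<^sup>-\<^sup>1(H)\<close>; this preimage is non-trivial, because
  otherwise \<open>p\<^sup>2\<close> elements would act injectively on the \<open>p\<close> cosets of \<open>H\<close>.\<close>

lemma (in comm_group) prime_dvd_card_fibre: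
  assumes p: "prime p" and V: "group V" "order V = p * p" and hom: "\<iota> \<in> hom V G"
    and H: "subgroup H G" "card (lcosets H) = p" and C: "C \<in> lcosets H"
  shows "p dvd card {v \<in> carrier V. \<iota> v <#\<^bsub>G\<^esub> C = C'}"
proof (cases "\<exists>v\<in>carrier V. \<iota> v <#\<^bsub>G\<^esub> C = C'")
  case False
  then have "{v \<in> carrier V. \<iota> v <#\<^bsub>G\<^esub> C = C'} = {}" by blast
  then show ?thesis by (simp only: card.empty dvd_0_right)
next
  case True
  interpret V: group V by fact
  interpret h: group_hom V G \<iota> by (simp add: group_hom_def group_hom_axioms_def hom is_group V)
  have pos: "0 < p" "1 < p" using p prime_gt_0_nat prime_gt_1_nat by blast+
  then have fin: "finite (carrier V)" using V by (simp add: order_def card_ge_0_finite)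
  define L where "L = {v \<in> carrier V. \<iota> v \<in> H}"
  have one: "\<one>\<^bsub>V\<^esub> \<in> L" by (simp add: L_def subgroup.one_closed[OF H(1)])
  have L: "subgroup L V"
  proof (rule V.subgroupI)
    show "L \<noteq> {}" using one by blast
  qed (auto simp: L_def subgroup.m_closed[OF H(1)] subgroup.m_inv_closed[OF H(1)])
  have iff: "\<iota> v <#\<^bsub>G\<^esub> C = \<iota> w <#\<^bsub>G\<^esub> C \<longleftrightarrow> inv\<^bsub>V\<^esub> v \<otimes>\<^bsub>V\<^esub> w \<in> L"
    if "v \<in> carrier V" "w \<in> carrier V" for v w
    using that by (simp add: lcos_lcoset_eq_iff[OF H(1) C] L_def)
  \<comment> \<open>A divisor of \<open>p * p\<close> is a power of \<open>p\<close>, so it remains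
    to exclude \<open>card L = 1\<close>.\<close>
  have "card L dvd p * p" using V.lagrange[OF L] V by (metis dvd_triv_right)
  then obtain i where i: "card L = p ^ i"
    using p by (metis divides_primepow_nat power2_eq_square)
  have "i \<noteq> 0"
  proof
    assume "i = 0"
    then have "card L = 1" using i by simp
    then have L1: "L = {\<one>\<^bsub>V\<^esub>}" using subgroup.one_closed[OF L] by (metis card_1_singletonE singletonD)
    have "inj_on (\<lambda>v. \<iota> v <#\<^bsub>G\<^esub> C) (carrier V)"
    proof (rule inj_onI)
      fix v w assume vw: "v \<in> carrier V" "w \<in> carrier V" and "\<iota> v <#\<^bsub>G\<^esub> C = \<iota> w <#\<^bsub>G\<^esub> C"
      then have "inv\<^bsub>V\<^esub> v \<otimes>\<^bsub>V\<^esub> w = \<one>\<^bsub>V\<^esub>" using iff L1 by simp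
      then show "v = w" using vw by (metis V.inv_closed V.inv_equality V.inv_inv)
    qed
    moreover have "(\<lambda>v. \<iota> v <#\<^bsub>G\<^esub> C) ` carrier V \<subseteq> lcosets H"
    proof clarify
      fix v assume v: "v \<in> carrier V"
      from C obtain k where k: "k \<in> carrier G" "C = k <#\<^bsub>G\<^esub> H" by (auto simp: LCOSETS_def)
      then have "\<iota> v <#\<^bsub>G\<^esub> C = (\<iota> v \<otimes> k) <#\<^bsub>G\<^esub> H" using v H by (simp add: lcos_m_assoc subgroup.subset)
      then show "\<iota> v <#\<^bsub>G\<^esub> C \<in> lcosets H" using v k by (auto simp: LCOSETS_def)
    qed
    moreover have "finite (lcosets H)" using H(2) pos by (simp add: card_ge_0_finite)
    ultimately have "p * p \<le> p" using V(2) H(2) by (metis card_inj_on_le order_def)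
    then show False using pos by simp
  qed
  then have "p dvd card L" using i by simp
  moreover obtain v where v: "v \<in> carrier V" "\<iota> v <#\<^bsub>G\<^esub> C = C'" using True by blast
  \<comment> \<open>Two elements carry \<open>C\<close> to the same coset iff they differ by an
    element of \<open>L\<close>, so the fibre is a coset of \<open>L\<close> and has as many
    elements.\<close>
  have "{w \<in> carrier V. \<iota> w <#\<^bsub>G\<^esub> C = C'} = v <#\<^bsub>V\<^esub> L"
  proof (rule Set.set_eqI)
    fix w
    have "w \<in> v <#\<^bsub>V\<^esub> L \<longleftrightarrow> w \<in> carrier V \<and> inv\<^bsub>V\<^esub> v \<otimes>\<^bsub>V\<^esub> w \<in> L"
      using v subgroup.lcos_module_imp[OF L V(1) v(1)] subgroup.lcos_module_rev[OF L V(1) v(1)]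
        subgroup.elemlcos_carrier[OF L V(1) v(1)] by blast
    then show "w \<in> {w \<in> carrier V. \<iota> w <#\<^bsub>G\<^esub> C = C'} \<longleftrightarrow> w \<in> v <#\<^bsub>V\<^esub> L"
      using iff v by auto
  qed
  moreover have "card L = card (v <#\<^bsub>V\<^esub> L)"
    using v L fin by (intro V.l_card_cosets_equal) (auto simp: LCOSETS_def subgroup.subset)
  ultimately show ?thesis by simp
qed

subsection \<open>The action of \<open>G\<close>\<close>

locale prime_set =
  fixes P :: "nat set"
  assumes prime: "p \<in> P \<Longrightarrow> prime p"
begin

abbreviation "G \<equiv> group_of P"

lemma pos [simp]: "p \<in> P \<Longrightarrow> 0 < p"
  using prime prime_gt_0_nat by blast

lemma comm_group_G: "comm_group G"
proof -
  have gr: "group (integer_mod_group p \<times>\<times> integer_mod_group p)" for p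
    by (simp add: DirProd_group)
  have *: "group G"
    by (simp add: group_of_def gr)
  show ?thesis
  proof (rule group.group_comm_groupI[OF *])
    fix x y assume "x \<in> carrier G" "y \<in> carrier G"
    then show "x \<otimes>\<^bsub>G\<^esub> y = y \<otimes>\<^bsub>G\<^esub> x"
      by (auto simp: group_of_def DirProd_def case_prod_beta add.commute)
  qed
qed

sublocale G: comm_group G
  by (rule comm_group_G)

lemma carrier_G:
  "g \<in> carrier G \<longleftrightarrow> g \<in> extensional P \<and> (\<forall>p\<in>P. g p \<in> {0..<int p} \<times> {0..<int p}) \<and>
     finite {p \<in> P. g p \<noteq> (0, 0)}"
proof -
  have gr: "group (integer_mod_group p \<times>\<times> integer_mod_group p)" for p
    by (simp add: DirProd_group)
  show ?thesis
    unfolding group_of_def carrier_sum_group[OF gr]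
    by (auto simp: PiE_iff carrier_integer_mod_group mem_Times_iff prime)
qed

lemma one_G: "p \<in> P \<Longrightarrow> \<one>\<^bsub>G\<^esub> p = (0, 0)"
  by (simp add: group_of_def)

lemma mult_G: "p \<in> P \<Longrightarrow> (g \<otimes>\<^bsub>G\<^esub> h) p =
    ((fst (g p) + fst (h p)) mod int p, (snd (g p) + snd (h p)) mod int p)"
  by (simp add: group_of_def DirProd_def case_prod_beta)

lemma G_eqI:
  "g \<in> carrier G \<Longrightarrow> h \<in> carrier G \<Longrightarrow> (\<And>p. p \<in> P \<Longrightarrow> g p = h p) \<Longrightarrow> g = h"
  by (auto simp: carrier_G intro: extensionalityI)

lemma upd_in_G:
  assumes "g \<in> carrier G" "p \<in> P" "v \<in> {0..<int p} \<times> {0..<int p}"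
  shows "g(p := v) \<in> carrier G"
proof -
  have "{q \<in> P. (g(p := v)) q \<noteq> (0, 0)} \<subseteq> insert p {q \<in> P. g q \<noteq> (0, 0)}" by auto
  moreover have "finite (insert p {q \<in> P. g q \<noteq> (0, 0)})" using assms by (simp add: carrier_G)
  ultimately have "finite {q \<in> P. (g(p := v)) q \<noteq> (0, 0)}" by (rule finite_subset)
  then show ?thesis using assms by (auto simp: carrier_G extensional_def)
qed

lemma kill_in_G [simp]: "g \<in> carrier G \<Longrightarrow> p \<in> P \<Longrightarrow> g(p := (0, 0)) \<in> carrier G"
  by (rule upd_in_G) auto

lemma kill_mult:
  assumes "g \<in> carrier G" "h \<in> carrier G" "p \<in> P"
  shows "(g \<otimes>\<^bsub>G\<^esub> h)(p := (0, 0)) = g(p := (0, 0)) \<otimes>\<^bsub>G\<^esub> h(p := (0, 0))"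
  using assms by (intro G_eqI) (auto simp: mult_G)

lemma lettersE:
  assumes "x \<in> letters P"
  obtains p H C i where "x = ((p, H, C), i)" "p \<in> P" "subgroup H G"
    "card (lcosets\<^bsub>G\<^esub> H) = p" "C \<in> lcosets\<^bsub>G\<^esub> H"
  using assms by (auto simp: letters_def cosets_of_index_def)

lemma in_letters [simp]:
  "((p, H, C), i) \<in> letters P \<longleftrightarrow>
    p \<in> P \<and> subgroup H G \<and> card (lcosets\<^bsub>G\<^esub> H) = p \<and> C \<in> lcosets\<^bsub>G\<^esub> H"
  by (auto simp: letters_def cosets_of_index_def)

lemma lcosetsE:
  assumes "C \<in> lcosets\<^bsub>G\<^esub> H"
  obtains k where "k \<in> carrier G" "C = k <#\<^bsub>G\<^esub> H"
  using assms by (auto simp: LCOSETS_def)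

lemma lcos_in_lcosets:
  assumes "g \<in> carrier G" "subgroup H G" "C \<in> lcosets\<^bsub>G\<^esub> H"
  shows "g <#\<^bsub>G\<^esub> C \<in> lcosets\<^bsub>G\<^esub> H"
proof -
  from assms(3) obtain k where k: "k \<in> carrier G" "C = k <#\<^bsub>G\<^esub> H" by (rule lcosetsE)
  then have "g <#\<^bsub>G\<^esub> C = (g \<otimes>\<^bsub>G\<^esub> k) <#\<^bsub>G\<^esub> H"
    using assms by (simp add: G.lcos_m_assoc subgroup.subset)
  then show ?thesis using k assms by (auto simp: LCOSETS_def)
qed

text \<open>Translation leaves the prime of a letter unchanged, so the cocycle rule reduces to
  multiplicativity of clearing the component at \<open>p\<close>.\<close>

sublocale self_similar_action G "letters P" "letter_act P" letter_res
proof
  fix g x assume g: "g \<in> carrier G" and x: "x \<in> letters P"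
  show "letter_act P g x \<in> letters P"
    using x g by (elim lettersE) (simp add: lcos_in_lcosets)
  show "letter_res g x \<in> carrier G"
    using x g by (elim lettersE) simp
  fix h assume h: "h \<in> carrier G"
  from x obtain p H C i where *: "x = ((p, H, C), i)" "p \<in> P" "subgroup H G" "C \<in> lcosets\<^bsub>G\<^esub> H"
    by (rule lettersE)
  then have "C \<subseteq> carrier G" using subgroup.lcosets_carrier[OF _ G.is_group] by blast
  then show "letter_act P (g \<otimes>\<^bsub>G\<^esub> h) x = letter_act P g (letter_act P h x)"
    using g h * by (simp add: G.lcos_m_assoc)
  show "letter_res (g \<otimes>\<^bsub>G\<^esub> h) x = letter_res g (letter_act P h x) \<otimes>\<^bsub>G\<^esub> letter_res h x"
    using g h * by (simp add: kill_mult)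
next
  fix x assume "x \<in> letters P"
  then obtain p H C i where *: "x = ((p, H, C), i)" "p \<in> P" "subgroup H G" "C \<in> lcosets\<^bsub>G\<^esub> H"
    by (rule lettersE)
  then have "C \<subseteq> carrier G" using subgroup.lcosets_carrier[OF _ G.is_group] by blast
  then show "letter_act P \<one>\<^bsub>G\<^esub> x = x" using * by (simp add: G.lcos_mult_one)
  show "letter_res \<one>\<^bsub>G\<^esub> x = \<one>\<^bsub>G\<^esub>"
    using * by (intro G_eqI) (auto simp: one_G)
qed

notation wact (infixr "\<bullet>" 75) and wres (infixl "\<restriction>" 75)

lemma semigroup_of_eq: "semigroup_of P = S"
  by (simp add: semigroup_of_def)

section \<open>Subgroups of index \<open>p\<close> cut out by linear functionals\<close>

lemma val_mult: "p \<in> P \<Longrightarrow> val p \<theta> ((g \<otimes>\<^bsub>G\<^esub> h) p) = (val p \<theta> (g p) + val p \<theta> (h p)) mod int p"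
proof -
  assume "p \<in> P"
  then have "val p \<theta> ((g \<otimes>\<^bsub>G\<^esub> h) p) =
    (fst \<theta> * (fst (g p) + fst (h p)) + snd \<theta> * (snd (g p) + snd (h p))) mod int p"
    by (simp add: val_def mult_G) (intro mod_add_cong mod_mult_cong; simp)
  also have "\<dots> = (val p \<theta> (g p) + val p \<theta> (h p)) mod int p"
    by (simp add: val_def mod_add_eq) (simp add: algebra_simps)
  finally show ?thesis .
qed

text \<open>For \<open>\<theta>\<close> in \<open>lines p\<close> these are the cosets of a subgroup
  of index \<open>p\<close>, so each affine line of \<open>C_p x C_p\<close> yields letters.\<close>

definition level :: "nat \<Rightarrow> int \<times> int \<Rightarrow> int \<Rightarrow> elt set"
  where "level p \<theta> r = {g \<in> carrier G. val p \<theta> (g p) = r}"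

lemma val_inv:
  assumes "p \<in> P" "g \<in> carrier G"
  shows "val p \<theta> ((inv\<^bsub>G\<^esub> g) p) = (- val p \<theta> (g p)) mod int p"
proof -
  have "(val p \<theta> ((inv\<^bsub>G\<^esub> g) p) + val p \<theta> (g p)) mod int p = 0"
    using assms val_mult[of p \<theta> "inv\<^bsub>G\<^esub> g" g] by (simp add: one_G) (simp add: val_def)
  then have "val p \<theta> ((inv\<^bsub>G\<^esub> g) p) mod int p = (- val p \<theta> (g p)) mod int p"
    by (metis add.inverse_inverse diff_minus_eq_add mod_0_imp_dvd mod_eq_dvd_iff)
  then show ?thesis by (simp add: val_def)
qed

lemma subgroup_level:
  assumes "p \<in> P"
  shows "subgroup (level p \<theta> 0) G"
proof (rule G.subgroupI)
  have "\<one>\<^bsub>G\<^esub> \<in> level p \<theta> 0" using assms by (simp add: level_def one_G) (simp add: val_def)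
  then show "level p \<theta> 0 \<noteq> {}" by blast
qed (use assms in \<open>auto simp: level_def val_mult val_inv\<close>)

lemma val_bounds [simp]: "p \<in> P \<Longrightarrow> 0 \<le> val p \<theta> v" "p \<in> P \<Longrightarrow> val p \<theta> v < int p"
  by (simp_all add: val_def)

lemma lcos_level:
  assumes p: "p \<in> P" and g: "g \<in> carrier G" and r: "r \<in> {0..<int p}"
  shows "g <#\<^bsub>G\<^esub> level p \<theta> r = level p \<theta> ((val p \<theta> (g p) + r) mod int p)"
proof
  show "g <#\<^bsub>G\<^esub> level p \<theta> r \<subseteq> level p \<theta> ((val p \<theta> (g p) + r) mod int p)"
    using p g by (auto simp: l_coset_def level_def val_mult)
  show "level p \<theta> ((val p \<theta> (g p) + r) mod int p) \<subseteq> g <#\<^bsub>G\<^esub> level p \<theta> r"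
  proof
    fix h assume h: "h \<in> level p \<theta> ((val p \<theta> (g p) + r) mod int p)"
    then have hG: "h \<in> carrier G" by (simp add: level_def)
    have "val p \<theta> ((inv\<^bsub>G\<^esub> g \<otimes>\<^bsub>G\<^esub> h) p) = r"
      using p g r h by (simp add: level_def val_mult val_inv mod_simps)
    then have "inv\<^bsub>G\<^esub> g \<otimes>\<^bsub>G\<^esub> h \<in> level p \<theta> r" using g hG by (simp add: level_def)
    moreover have "h = g \<otimes>\<^bsub>G\<^esub> (inv\<^bsub>G\<^esub> g \<otimes>\<^bsub>G\<^esub> h)"
      using g hG by (simp flip: G.m_assoc)
    ultimately show "h \<in> g <#\<^bsub>G\<^esub> level p \<theta> r" by (auto simp: l_coset_def)
  qed
qed

lemma level_nonempty:
  assumes p: "p \<in> P" and l: "\<theta> \<in> lines p" and r: "r \<in> {0..<int p}"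
  shows "\<exists>g. g \<in> level p \<theta> r"
proof -
  \<comment> \<open>The point is put on an axis where \<open>\<theta>\<close> has coefficient
    1.\<close>
  define v where "v = (if \<theta> = (0, 1) then (0, r) else (r, 0))"
  have "v \<in> {0..<int p} \<times> {0..<int p}" using r by (auto simp: v_def)
  moreover have "val p \<theta> v = r" using l r by (auto simp: v_def val_def lines_def)
  ultimately have "\<one>\<^bsub>G\<^esub>(p := v) \<in> level p \<theta> r" using p by (simp add: level_def upd_in_G)
  then show ?thesis by blast
qed

lemma lcosets_level:
  assumes p: "p \<in> P" and l: "\<theta> \<in> lines p"
  shows "lcosets\<^bsub>G\<^esub> (level p \<theta> 0) = level p \<theta> ` {0..<int p}"
proof
  show "lcosets\<^bsub>G\<^esub> (level p \<theta> 0) \<subseteq> level p \<theta> ` {0..<int p}"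
    using p by (auto simp: LCOSETS_def lcos_level)
  show "level p \<theta> ` {0..<int p} \<subseteq> lcosets\<^bsub>G\<^esub> (level p \<theta> 0)"
  proof
    fix C assume "C \<in> level p \<theta> ` {0..<int p}"
    then obtain r where r: "r \<in> {0..<int p}" "C = level p \<theta> r" by blast
    with level_nonempty[OF p l] obtain g where "g \<in> carrier G" "val p \<theta> (g p) = r"
      unfolding level_def by blast
    with r p show "C \<in> lcosets\<^bsub>G\<^esub> (level p \<theta> 0)"
      by (auto simp: LCOSETS_def lcos_level intro!: bexI[of _ g])
  qed
qed

text \<open>Levels are pairwise disjoint and non-empty, so there are exactly \<open>p\<close>
  cosets.\<close>

lemma level_letter:
  assumes p: "p \<in> P" and l: "\<theta> \<in> lines p" and r: "r \<in> {0..<int p}"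
  shows "((p, level p \<theta> 0, level p \<theta> r), i) \<in> letters P"
proof -
  have "inj_on (level p \<theta>) {0..<int p}"
  proof (rule inj_onI)
    fix r r' assume "r \<in> {0..<int p}" and eq: "level p \<theta> r = level p \<theta> r'"
    then obtain g where "g \<in> level p \<theta> r" using level_nonempty[OF p l] by blast
    moreover from this have "g \<in> level p \<theta> r'" using eq by simp
    ultimately show "r = r'" by (simp add: level_def)
  qed
  then have "card (lcosets\<^bsub>G\<^esub> (level p \<theta> 0)) = p"
    by (simp add: lcosets_level[OF p l] card_image)
  then show ?thesis using p r subgroup_level by (simp add: lcosets_level[OF p l])
qed

text \<open>This links a relation that products in the hull can test, \<open>g\<close> carrying one
  letter to another, with the component of \<open>g\<close> at \<open>p\<close> lying on a given
  line.\<close>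

lemma level_letter_act:
  assumes p: "p \<in> P" and l: "\<theta> \<in> lines p" and r: "r \<in> {0..<int p}" and g: "g \<in> carrier G"
  shows "letter_act P g ((p, level p \<theta> 0, level p \<theta> 0), i) = ((p, level p \<theta> 0, level p \<theta> r), i)
     \<longleftrightarrow> val p \<theta> (g p) = r"
proof -
  have "level p \<theta> (val p \<theta> (g p)) = level p \<theta> r \<longleftrightarrow> val p \<theta> (g p) = r"
    proof
    assume eq: "level p \<theta> (val p \<theta> (g p)) = level p \<theta> r"
    obtain h where "h \<in> level p \<theta> r" using level_nonempty[OF p l r] by blast
    moreover from this have "h \<in> level p \<theta> (val p \<theta> (g p))" using eq by simp
    ultimately show "val p \<theta> (g p) = r" by (simp add: level_def)
  qed simp
  then show ?thesis using p g by (simp add: lcos_level)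
qed

subsection \<open>Characteristic not in \<open>\<P>\<close>\<close>

lemma snd_letter_act [simp]: "snd (letter_act P g x) = snd x"
  by (cases "(P, g, x)" rule: letter_act.cases) simp

lemma snd_word_act: "snd ` set (g \<bullet> w) = snd ` set w"
  by (induction w arbitrary: g) simp_all

text \<open>Letters with an index occurring nowhere else cut out a single pair of outer words,
  because \<open>G\<close> does not change the index of a letter.\<close>

lemma sandwich_hull:
  assumes mem: "u \<in> lists (letters P)" "g \<in> carrier G" "v \<in> lists (letters P)"
      "u\<^sub>0 \<in> lists (letters P)" "v\<^sub>0 \<in> lists (letters P)" "x \<in> letters P" "y \<in> letters P"
    and len: "length u\<^sub>0 \<le> length u"
    and fresh: "snd x = i" "snd y = i" "i \<notin> snd ` (set u \<union> set v \<union> set v\<^sub>0)"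
  shows "Some ([], \<one>\<^bsub>G\<^esub>, u\<^sub>0 @ [y]) \<otimes>\<^bsub>S\<^esub> (Some (u, g, v) \<otimes>\<^bsub>S\<^esub> Some (v\<^sub>0 @ [x], \<one>\<^bsub>G\<^esub>, [])) =
    (if u = u\<^sub>0 \<and> v = v\<^sub>0 \<and> letter_act P g x = y then Some ([], letter_res g x, []) else None)"
proof -
  have nx: "x \<notin> set v" using fresh by auto
  then have nv: "\<not> prefix (v\<^sub>0 @ [x]) v"
    by (auto simp: prefix_def)
  show ?thesis
  proof (cases "prefix v v\<^sub>0")
    case True
    then obtain r where r: "v\<^sub>0 = v @ r" by (auto simp: prefix_def)
    have rl: "r \<in> lists (letters P)" using r mem by simp
    define c where "c = letter_act P (g \<restriction> r) x"
    let ?w = "u @ (g \<bullet> r) @ [c]"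
    \<comment> \<open>The index of \<open>y\<close> is new to \<open>u\<close> and
      \<open>v\<^sub>0\<close>, and the action on \<open>r\<close>, a part of
      \<open>v\<^sub>0\<close>, preserves indices.\<close>
    have y: "y \<notin> set (u @ g \<bullet> r)"
    proof
      assume "y \<in> set (u @ g \<bullet> r)"
      then have "snd y \<in> snd ` set u \<union> snd ` set (g \<bullet> r)" by auto
      then show False using fresh unfolding snd_word_act by (auto simp: r)
    qed
    have prod: "Some (u, g, v) \<otimes>\<^bsub>S\<^esub> Some (v\<^sub>0 @ [x], \<one>\<^bsub>G\<^esub>, []) =
        Some (?w, letter_res (g \<restriction> r) x, [])"
      using mem rl by (simp add: r c_def)
    \<comment> \<open>As \<open>y\<close> is new, it can only match the last letter
      \<open>c\<close>; then \<open>u\<^sub>0 = u @ (g \<bullet> r)\<close>, and the length bound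
      forces \<open>r = []\<close>.\<close>
    have pre: "prefix (u\<^sub>0 @ [y]) ?w \<longleftrightarrow> u\<^sub>0 = u \<and> r = [] \<and> y = c"
    proof
      assume "prefix (u\<^sub>0 @ [y]) ?w"
      then have "u\<^sub>0 @ [y] = ?w \<or> prefix (u\<^sub>0 @ [y]) (u @ g \<bullet> r)"
        using prefix_snoc[of "u\<^sub>0 @ [y]" "u @ g \<bullet> r" c] by simp
      moreover have "y \<in> set (u @ g \<bullet> r)" if "prefix (u\<^sub>0 @ [y]) (u @ g \<bullet> r)"
        using set_mono_prefix[OF that] by simp
      ultimately have "u\<^sub>0 @ [y] = ?w" using y by blast
      then have eq: "u\<^sub>0 = u @ g \<bullet> r" "y = c" by (simp_all flip: append_assoc)
      then have "length r = 0" using len by simp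
      then show "u\<^sub>0 = u \<and> r = [] \<and> y = c" using eq by simp
    qed auto
    \<comment> \<open>The length bound leaves equality as the only possibility.\<close>
    have pre': "u\<^sub>0 @ [y] = ?w" if "prefix ?w (u\<^sub>0 @ [y])"
    proof -
      have "length (u\<^sub>0 @ [y]) \<le> length ?w" using len by simp
      then show ?thesis using that by (metis le_antisym not_equal_is_parallel parallelD2 prefix_length_le prefix_order.refl)
    qed
    show ?thesis
    proof (cases "u\<^sub>0 = u \<and> r = [] \<and> y = c")
      case True
      then show ?thesis unfolding prod using r mem by (simp add: c_def)
    next
      case False
      then have "\<not> prefix (u\<^sub>0 @ [y]) ?w" "\<not> prefix ?w (u\<^sub>0 @ [y])"
        using pre pre' by auto
      moreover have "\<not> (u = u\<^sub>0 \<and> v = v\<^sub>0 \<and> letter_act P g x = y)"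
        using False by (auto simp: r c_def)
      ultimately show ?thesis unfolding prod unfolding mult_hull hull_mult.simps by (simp only: if_False)
    qed
  next
    case False
    \<comment> \<open>A prefix of \<open>v\<^sub>0 @ [x]\<close> is a prefix of
      \<open>v\<^sub>0\<close> or contains \<open>x\<close>.\<close>
    then have "\<not> prefix v (v\<^sub>0 @ [x])" using nx by auto
    with nv have "Some (u, g, v) \<otimes>\<^bsub>S\<^esub> Some (v\<^sub>0 @ [x], \<one>\<^bsub>G\<^esub>, []) = None"
      unfolding mult_hull hull_mult.simps by (simp only: if_False)
    moreover have "v \<noteq> v\<^sub>0" using False by auto
    ultimately show ?thesis by simp
  qed
qed

section \<open>Isolating the coefficients along one line\<close>

lemma fresh_index:
  fixes f :: "(letter list \<times> elt \<times> letter list) option \<Rightarrow>\<^sub>0 'k::zero"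
  shows "\<exists>i. \<forall>u g v. Some (u, g, v) \<in> Poly_Mapping.keys f \<longrightarrow> i \<notin> snd ` (set u \<union> set v)"
proof -
  let ?L = "\<Union>s\<in>Poly_Mapping.keys f. case s of None \<Rightarrow> {} | Some (u, g, v) \<Rightarrow> snd ` (set u \<union> set v)"
  \<comment> \<open>Only finitely many indices occur in \<open>f\<close>, and letters carry indices
    from an infinite set, so a new one exists.\<close>
  have "finite ?L" by (auto split: option.split)
  then obtain i where "i \<notin> ?L" using ex_new_if_finite[of ?L] by auto
  have "i \<notin> snd ` (set u \<union> set v)" if "Some (u, g, v) \<in> Poly_Mapping.keys f" for u g v
  proof -
    have "i \<notin> (case Some (u, g, v) of None \<Rightarrow> {} | Some (u, g, v) \<Rightarrow> snd ` (set u \<union> set v))"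
      using that \<open>i \<notin> ?L\<close> by blast
    then show ?thesis by simp
  qed
  then show ?thesis by blast
qed

lemma keys_in_hull:
  assumes "f \<in> carrier A.algebra" "Some (u, g, v) \<in> Poly_Mapping.keys f"
  shows "u \<in> lists (letters P)" "g \<in> carrier G" "v \<in> lists (letters P)"
proof -
  have "Some (u, g, v) \<in> carrier S" using assms unfolding A.carrier_algebra by blast
  then show "u \<in> lists (letters P)" "g \<in> carrier G" "v \<in> lists (letters P)"
    unfolding Some_in_hull by blast+
qed

text \<open>The product of \<open>e\<close>, a term of \<open>f\<close> and \<open>e'\<close> is
  non-zero only if the term has outer words \<open>u\<^sub>0\<close> and \<open>v\<^sub>0\<close>
  and its group element carries \<open>x\<close> to \<open>y\<close>; what is left is the
  restriction of that element at \<open>x\<close>. Minimality of \<open>u\<^sub>0\<close> supplies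
  the length bound of \<open>sandwich_hull\<close>.\<close>

lemma extract_line:
  fixes f :: "(letter list \<times> elt \<times> letter list) option \<Rightarrow>\<^sub>0 'k::field"
  assumes f: "f \<in> carrier A.algebra"
    and s\<^sub>0: "Some (u\<^sub>0, g\<^sub>0, v\<^sub>0) \<in> Poly_Mapping.keys f"
    and min: "\<And>u g v. Some (u, g, v) \<in> Poly_Mapping.keys f \<Longrightarrow> length u\<^sub>0 \<le> length u"
    and p: "p \<in> P" and l: "\<theta> \<in> lines p" and r: "r \<in> {0..<int p}"
  obtains e e' where "e \<in> carrier S - {None}" "e' \<in> carrier S - {None}"
    "Poly_Mapping.single e 1 \<otimes>\<^bsub>A.algebra\<^esub> (f \<otimes>\<^bsub>A.algebra\<^esub> Poly_Mapping.single e' 1) =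
      (\<Sum>g | Some (u\<^sub>0, g, v\<^sub>0) \<in> Poly_Mapping.keys f \<and> val p \<theta> (g p) = r.
         Poly_Mapping.single (Some ([], g(p := (0, 0)), [])) (Poly_Mapping.lookup f (Some (u\<^sub>0, g, v\<^sub>0))))"
proof -
  obtain i where i: "\<And>u g v. Some (u, g, v) \<in> Poly_Mapping.keys f \<Longrightarrow> i \<notin> snd ` (set u \<union> set v)"
    using fresh_index[of f] by blast
  \<comment> \<open>Both letters come from the functional \<open>\<theta>\<close>, at levels 0 and
    \<open>r\<close>, so \<open>g\<close> carries \<open>x\<close> to \<open>y\<close> exactly when
    its component at \<open>p\<close> has value \<open>r\<close>.\<close>
  define x where "x = ((p, level p \<theta> 0, level p \<theta> 0), i)"
  define y where "y = ((p, level p \<theta> 0, level p \<theta> r), i)"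
  have xy: "x \<in> letters P" "y \<in> letters P"
    unfolding x_def y_def using p r by (intro level_letter[OF p l]; simp)+
  note keys = keys_in_hull[OF f]
  note mem\<^sub>0 = keys[OF s\<^sub>0]
  define e where "e = Some ([]::letter list, \<one>\<^bsub>G\<^esub>, u\<^sub>0 @ [y])"
  define e' where "e' = Some (v\<^sub>0 @ [x], \<one>\<^bsub>G\<^esub>, []::letter list)"
  have ee: "e \<in> carrier S - {None}" "e' \<in> carrier S - {None}"
    unfolding e_def e'_def using mem\<^sub>0 xy by simp_all
  define F where "F = {g. Some (u\<^sub>0, g, v\<^sub>0) \<in> Poly_Mapping.keys f \<and> val p \<theta> (g p) = r}"
  have prod: "e \<otimes>\<^bsub>S\<^esub> (Some (u, g, v) \<otimes>\<^bsub>S\<^esub> e') =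
      (if u = u\<^sub>0 \<and> v = v\<^sub>0 \<and> g \<in> F then Some ([], g(p := (0, 0)), []) else None)"
    if s: "Some (u, g, v) \<in> Poly_Mapping.keys f" for u g v
  proof -
    have "e \<otimes>\<^bsub>S\<^esub> (Some (u, g, v) \<otimes>\<^bsub>S\<^esub> e') =
      (if u = u\<^sub>0 \<and> v = v\<^sub>0 \<and> letter_act P g x = y then Some ([], letter_res g x, []) else None)"
      unfolding e_def e'_def
      by (rule sandwich_hull[where i = i]) (use keys[OF s] mem\<^sub>0 xy i[OF s] i[OF s\<^sub>0] min[OF s] in \<open>auto simp: x_def y_def\<close>)
    moreover have "letter_act P g x = y \<longleftrightarrow> val p \<theta> (g p) = r"
      unfolding x_def y_def by (rule level_letter_act[OF p l r keys(2)[OF s]])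
    ultimately show ?thesis using s by (auto simp: F_def x_def simp del: letter_act.simps mult_hull)
  qed
  let ?j = "\<lambda>g. Some (u\<^sub>0, g, v\<^sub>0)"
  have "Poly_Mapping.single e 1 \<otimes>\<^bsub>A.algebra\<^esub> (f \<otimes>\<^bsub>A.algebra\<^esub> Poly_Mapping.single e' 1) =
      (\<Sum>s\<in>Poly_Mapping.keys f. A.basis (e \<otimes>\<^bsub>S\<^esub> (s \<otimes>\<^bsub>S\<^esub> e')) (Poly_Mapping.lookup f s))"
    by (rule A.sandwich_algebra[OF f ee])
  \<comment> \<open>All other terms have product \<open>None\<close>, which \<open>basis\<close>
    sends to 0.\<close>
  also have "\<dots> = (\<Sum>s\<in>?j ` F. A.basis (e \<otimes>\<^bsub>S\<^esub> (s \<otimes>\<^bsub>S\<^esub> e')) (Poly_Mapping.lookup f s))"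
  proof (rule sum.mono_neutral_right)
    show "\<forall>s\<in>Poly_Mapping.keys f - ?j ` F.
        A.basis (e \<otimes>\<^bsub>S\<^esub> (s \<otimes>\<^bsub>S\<^esub> e')) (Poly_Mapping.lookup f s) = 0"
    proof
      fix s assume s: "s \<in> Poly_Mapping.keys f - ?j ` F"
      then obtain u g v where [simp]: "s = Some (u, g, v)"
        using f unfolding A.carrier_algebra by (cases s) auto
      have "e \<otimes>\<^bsub>S\<^esub> (s \<otimes>\<^bsub>S\<^esub> e') = None" using s prod[of u g v] by auto
      then show "A.basis (e \<otimes>\<^bsub>S\<^esub> (s \<otimes>\<^bsub>S\<^esub> e')) (Poly_Mapping.lookup f s) = 0" by simp
    qed
  qed (auto simp: F_def)
  also have "\<dots> = (\<Sum>g\<in>F. A.basis (e \<otimes>\<^bsub>S\<^esub> (?j g \<otimes>\<^bsub>S\<^esub> e')) (Poly_Mapping.lookup f (?j g)))"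
    by (subst sum.reindex) (auto simp: inj_on_def)
  also have "\<dots> = (\<Sum>g\<in>F. Poly_Mapping.single (Some ([], g(p := (0, 0)), [])) (Poly_Mapping.lookup f (?j g)))"
  proof (rule sum.cong[OF refl])
    fix g assume "g \<in> F"
    then have "e \<otimes>\<^bsub>S\<^esub> (?j g \<otimes>\<^bsub>S\<^esub> e') = Some ([], g(p := (0, 0)), [])"
      using prod[of u\<^sub>0 g v\<^sub>0] by (simp add: F_def)
    then show "A.basis (e \<otimes>\<^bsub>S\<^esub> (?j g \<otimes>\<^bsub>S\<^esub> e')) (Poly_Mapping.lookup f (?j g)) =
        Poly_Mapping.single (Some ([], g(p := (0, 0)), [])) (Poly_Mapping.lookup f (?j g))"
      by (simp add: A.basis_def)
  qed
  finally show ?thesis using that ee unfolding F_def by blast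
qed

text \<open>If all these sums vanished, so would their coefficients at \<open>g\<^sub>0\<close> with
  the component at \<open>p\<close> cleared. Only elements \<open>g\<^sub>0(p := v)\<close>
  contribute there, so these coefficients are the line sums of a function on the plane, and
  \<open>line_sums\<close> makes \<open>p\<close> times the non-zero coefficient of
  \<open>g\<^sub>0\<close> vanish.\<close>

lemma exists_nonzero_line:
  fixes f :: "(letter list \<times> elt \<times> letter list) option \<Rightarrow>\<^sub>0 'k::field"
  assumes char: "CHAR('k) \<notin> P"
    and f: "f \<in> carrier A.algebra"
    and s\<^sub>0: "Some (u\<^sub>0, g\<^sub>0, v\<^sub>0) \<in> Poly_Mapping.keys f"
    and p: "p \<in> P"
  obtains \<theta> r where "\<theta> \<in> lines p" "r \<in> {0..<int p}"
    "(\<Sum>g | Some (u\<^sub>0, g, v\<^sub>0) \<in> Poly_Mapping.keys f \<and> val p \<theta> (g p) = r.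
       Poly_Mapping.single (Some ([], g(p := (0, 0)), [])) (Poly_Mapping.lookup f (Some (u\<^sub>0, g, v\<^sub>0)))) \<noteq>
     (0 :: (letter list \<times> elt \<times> letter list) option \<Rightarrow>\<^sub>0 'k)"
proof (rule ccontr)
  let ?V = "{0..<int p} \<times> {0..<int p}"
  let ?F = "\<lambda>\<theta> r. {g. Some (u\<^sub>0, g, v\<^sub>0) \<in> Poly_Mapping.keys f \<and> val p \<theta> (g p) = r}"
  let ?c = "\<lambda>g. Poly_Mapping.lookup f (Some (u\<^sub>0, g, v\<^sub>0))"
  let ?h = "g\<^sub>0(p := (0, 0))"
  note in_G = keys_in_hull(2)[OF f] and contra = that
  assume "\<not> thesis"
  then have zero: "(\<Sum>g\<in>?F \<theta> r. Poly_Mapping.single (Some ([], g(p := (0, 0)), [])) (?c g)) =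
      (0 :: (letter list \<times> elt \<times> letter list) option \<Rightarrow>\<^sub>0 'k)"
    if "\<theta> \<in> lines p" "r \<in> {0..<int p}" for \<theta> r
    using that contra \<open>\<not> thesis\<close> by blast
  \<comment> \<open>The trivial update presents \<open>g\<^sub>0\<close> as the member of the family
    \<open>g\<^sub>0(p := v)\<close> at the point \<open>g\<^sub>0 p\<close>.\<close>
  have "of_nat p * ?c (g\<^sub>0(p := g\<^sub>0 p)) = 0"
  proof (rule line_sums[where d = "\<lambda>v. ?c (g\<^sub>0(p := v))"])
    show "prime p" using p by (rule prime)
    show "g\<^sub>0 p \<in> ?V" using in_G[OF s\<^sub>0] p by (simp add: carrier_G)
    fix \<theta> r assume \<theta>: "\<theta> \<in> lines p" and r: "r \<in> {0..<int p}"
    have fin: "finite (?F \<theta> r)"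
      by (rule finite_subset[OF _ finite_vimageI[of "Poly_Mapping.keys f" "\<lambda>g. Some (u\<^sub>0, g, v\<^sub>0)"]])
        (auto simp: inj_on_def)
    \<comment> \<open>\<open>?B\<close> covers all points of the line; those outside the support of
      \<open>f\<close> have coefficient 0.\<close>
    let ?B = "(\<lambda>v. g\<^sub>0(p := v)) ` {v. v \<in> ?V \<and> val p \<theta> v = r}"
    have "(\<Sum>v | v \<in> ?V \<and> val p \<theta> v = r. ?c (g\<^sub>0(p := v))) = (\<Sum>g\<in>?B. ?c g)"
      by (subst sum.reindex) (auto simp: inj_on_def dest: fun_upd_eqD)
    also have "\<dots> = (\<Sum>g\<in>{g \<in> ?F \<theta> r. g(p := (0, 0)) = ?h}. ?c g)"
    proof (rule sum.mono_neutral_right)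
      show "finite ?B" by (rule finite_imageI, rule finite_subset[of _ ?V]) auto
      show "{g \<in> ?F \<theta> r. g(p := (0, 0)) = ?h} \<subseteq> ?B"
      proof
        fix g assume g: "g \<in> {g \<in> ?F \<theta> r. g(p := (0, 0)) = ?h}"
        then have "g \<in> carrier G" using in_G by blast
        then have "g p \<in> ?V" using p by (simp add: carrier_G)
        then have V: "g p \<in> {v. v \<in> ?V \<and> val p \<theta> v = r}" using g by blast
        have "g = g\<^sub>0(p := g p)"
        proof -
          have "g = (g(p := (0, 0)))(p := g p)" by simp
          also have "g(p := (0, 0)) = ?h" using g by blast
          finally show ?thesis unfolding fun_upd_upd .
        qed
        then show "g \<in> ?B" using V by (rule image_eqI)
      qed
      show "\<forall>g\<in>?B - {g \<in> ?F \<theta> r. g(p := (0, 0)) = ?h}. ?c g = 0"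
        by (auto simp: in_keys_iff)
    qed
    also have "\<dots> = (\<Sum>g\<in>?F \<theta> r. if g(p := (0, 0)) = ?h then ?c g else 0)"
      using fin by (rule sum.inter_filter)
    also have "\<dots> = Poly_Mapping.lookup
        (\<Sum>g\<in>?F \<theta> r. Poly_Mapping.single (Some ([], g(p := (0, 0)), [])) (?c g))
        (Some ([], ?h, []) :: (letter list \<times> elt \<times> letter list) option)"
      by (simp add: lookup_sum lookup_single when_def)
    also have "\<dots> = 0" by (simp only: zero[OF \<theta> r] lookup_zero)
    finally show "(\<Sum>v | v \<in> ?V \<and> val p \<theta> v = r. ?c (g\<^sub>0(p := v))) = 0" .
  qed
  then have "(of_nat p :: 'k) = 0" using s\<^sub>0 by (simp add: in_keys_iff)
  then have "CHAR('k) dvd p" by (simp add: of_nat_eq_0_iff_char_dvd)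
  then have "CHAR('k) = 1 \<or> CHAR('k) = p" using prime[OF p] prime_nat_iff by blast
  then have "CHAR('k) = p" using CHAR_not_1'[where 'a = 'k] by simp
  then show False using char p by simp
qed

text \<open>The new element is a two-sided multiple of \<open>f\<close>. It has empty outer words,
  and its group elements are those of \<open>f\<close> with the component at \<open>p\<close>
  cleared, so primes cleared earlier stay cleared.\<close>

lemma ideal_project:
  fixes I :: "((letter list \<times> elt \<times> letter list) option \<Rightarrow>\<^sub>0 'k::field) set"
  assumes I: "ideal I A.algebra" and char: "CHAR('k) \<notin> P"
    and f: "f \<in> I" "f \<noteq> 0" and p: "p \<in> P"
  obtains f' u v where "f' \<in> I" "f' \<noteq> 0"
    "Poly_Mapping.keys f' \<subseteq> (\<lambda>g. Some ([], g(p := (0, 0)), [])) ` {g. Some (u, g, v) \<in> Poly_Mapping.keys f}"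
proof -
  interpret I: ideal I "A.algebra :: ('k, _) module" by fact
  have fA: "f \<in> carrier A.algebra" using f I.a_subset by blast
  have ex: "\<exists>u g v. s = Some (u, g, v)" if "s \<in> Poly_Mapping.keys f" for s
    using that fA unfolding A.carrier_algebra by (cases s) auto
  \<comment> \<open>A key whose left word has least length is chosen, as the isolation of a line
    demands.\<close>
  have "\<exists>n u g v. Some (u, g, v) \<in> Poly_Mapping.keys f \<and> length u = n"
    using f ex by (metis all_not_in_conv keys_eq_empty)
  then obtain u g v where s: "Some (u, g, v) \<in> Poly_Mapping.keys f"
    and min: "\<And>u' g' v'. Some (u', g', v') \<in> Poly_Mapping.keys f \<Longrightarrow> length u \<le> length u'"
    using exists_least_iff[of "\<lambda>n. \<exists>u g v. Some (u, g, v) \<in> Poly_Mapping.keys f \<and> length u = n"]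
    by (metis not_le_imp_less)
  obtain \<theta> r where \<theta>: "\<theta> \<in> lines p" "r \<in> {0..<int p}" and nz:
    "(\<Sum>g | Some (u, g, v) \<in> Poly_Mapping.keys f \<and> val p \<theta> (g p) = r.
       Poly_Mapping.single (Some ([], g(p := (0, 0)), [])) (Poly_Mapping.lookup f (Some (u, g, v)))) \<noteq>
     (0 :: (letter list \<times> elt \<times> letter list) option \<Rightarrow>\<^sub>0 'k)" (is "?f' \<noteq> 0")
    by (rule exists_nonzero_line[OF char fA s p])
  obtain e e' where e: "e \<in> carrier S - {None}" "e' \<in> carrier S - {None}" and eq:
    "Poly_Mapping.single e 1 \<otimes>\<^bsub>A.algebra\<^esub> (f \<otimes>\<^bsub>A.algebra\<^esub> Poly_Mapping.single e' 1) = ?f'"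
    by (rule extract_line[OF fA s min p \<theta>])
  have "?f' \<in> I"
    unfolding eq[symmetric]
    by (intro I.I_l_closed I.I_r_closed f A.single_in_algebra e)
  moreover have "Poly_Mapping.keys ?f' \<subseteq>
      (\<lambda>g. Some ([], g(p := (0, 0)), [])) ` {g. Some (u, g, v) \<in> Poly_Mapping.keys f}"
    by (rule order_trans[OF keys_sum]) (auto split: if_splits)
  ultimately show thesis using nz that by blast
qed

text \<open>Induction on the set \<open>Q\<close> of primes that may still occur: each projection
  removes one, and a non-zero element in which none is left is an invertible multiple of the
  unit.\<close>

lemma one_in_ideal:
  fixes I :: "((letter list \<times> elt \<times> letter list) option \<Rightarrow>\<^sub>0 'k::field) set"
  assumes I: "ideal I A.algebra" and char: "CHAR('k) \<notin> P"
    and "finite Q" "Q \<subseteq> P" "f \<in> I" "f \<noteq> 0"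
    and "Poly_Mapping.keys f \<subseteq> {Some ([], g, []) | g. g \<in> carrier G \<and> (\<forall>q\<in>P - Q. g q = (0, 0))}"
  shows "\<one>\<^bsub>A.algebra\<^esub> \<in> I"
  using assms(3-)
proof (induction Q arbitrary: f rule: finite_induct)
  case empty
  interpret I: ideal I "A.algebra :: ('k, _) module" by fact
  have "g = \<one>\<^bsub>G\<^esub>" if "g \<in> carrier G" "\<forall>q\<in>P. g q = (0, 0)" for g
    using that by (intro G_eqI) (auto simp: one_G)
  then have keys: "Poly_Mapping.keys f \<subseteq> {\<one>\<^bsub>S\<^esub>}" using empty.prems by auto
  define c where "c = Poly_Mapping.lookup f \<one>\<^bsub>S\<^esub>"
  have "f = Poly_Mapping.single \<one>\<^bsub>S\<^esub> c"
    using keys by (intro poly_mapping_eqI) (auto simp: c_def lookup_single when_def in_keys_iff)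
  moreover from this have "c \<noteq> 0" using empty.prems by auto
  ultimately have "Poly_Mapping.single \<one>\<^bsub>S\<^esub> (1 / c) \<otimes>\<^bsub>A.algebra\<^esub> f = \<one>\<^bsub>A.algebra\<^esub>"
    by (simp add: A.basis_def)
  moreover have "Poly_Mapping.single \<one>\<^bsub>S\<^esub> (1 / c) \<in> carrier A.algebra" by simp
  ultimately show ?case using I.I_l_closed[OF \<open>f \<in> I\<close>] by metis
next
  case (insert p Q)
  then have p: "p \<in> P" by simp
  obtain f' u v where f': "f' \<in> I" "f' \<noteq> 0" and keys:
    "Poly_Mapping.keys f' \<subseteq> (\<lambda>g. Some ([], g(p := (0, 0)), [])) ` {g. Some (u, g, v) \<in> Poly_Mapping.keys f}"
    by (rule ideal_project[OF I char insert.prems(2,3) p])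
  show ?case
  proof (rule insert.IH[OF _ f'])
    show "Poly_Mapping.keys f' \<subseteq> {Some ([], g, []) | g. g \<in> carrier G \<and> (\<forall>q\<in>P - Q. g q = (0, 0))}"
    proof
      fix s assume "s \<in> Poly_Mapping.keys f'"
      then obtain g where g: "s = Some ([], g(p := (0, 0)), [])" "Some (u, g, v) \<in> Poly_Mapping.keys f"
        using keys by blast
      then have "g \<in> carrier G" "\<forall>q\<in>P - insert p Q. g q = (0, 0)"
        using insert.prems(4) by blast+
      then show "s \<in> {Some ([], g, []) | g. g \<in> carrier G \<and> (\<forall>q\<in>P - Q. g q = (0, 0))}"
        using g p by (auto intro!: kill_in_G)
    qed
  qed (use insert.prems in auto)
qed

lemma carrier_neq_zero: "carrier (A.algebra :: ('k::field, _) module) \<noteq> {\<zero>\<^bsub>A.algebra\<^esub>}"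
proof -
  have "Poly_Mapping.single \<one>\<^bsub>S\<^esub> (1::'k) \<in> carrier A.algebra" by simp
  moreover have "Poly_Mapping.single \<one>\<^bsub>S\<^esub> (1::'k) \<noteq> 0"
    by (metis lookup_single_eq lookup_zero zero_neq_one)
  ultimately show ?thesis by (metis A.ops_algebra(1) singletonD)
qed

lemma simple_if_char:
  assumes char: "CHAR('k::field) \<notin> P"
  shows "simple_algebra (A.algebra :: ('k, _) module)"
  unfolding simple_algebra_def
proof (intro conjI allI impI A.ring_algebra carrier_neq_zero)
  fix I :: "((letter list \<times> elt \<times> letter list) option \<Rightarrow>\<^sub>0 'k) set"
  assume "ideal I A.algebra \<and> (\<forall>c. \<forall>f\<in>I. c \<odot>\<^bsub>A.algebra\<^esub> f \<in> I)"
  then have I: "ideal I A.algebra" by blast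
  interpret I: ideal I "A.algebra :: ('k, _) module" by fact
  show "I = {\<zero>\<^bsub>A.algebra\<^esub>} \<or> I = carrier A.algebra"
  proof (cases "I = {0}")
    case False
    moreover have "0 \<in> I" using additive_subgroup.zero_closed[OF I.is_additive_subgroup] by simp
    ultimately obtain f where f: "f \<in> I" "f \<noteq> 0" by blast
    then have fA: "Poly_Mapping.keys f \<subseteq> carrier S - {None}"
      using I.a_subset unfolding A.carrier_algebra by blast
    have "\<one>\<^bsub>A.algebra\<^esub> \<in> I"
    \<comment> \<open>Without primes there are no letters and all words are empty already; otherwise
      one projection, at any prime, removes the outer words.\<close>
    proof (cases "P = {}")
      case True
      have keys: "Poly_Mapping.keys f \<subseteq>
          {Some ([], g, []) | g. g \<in> carrier G \<and> (\<forall>q\<in>P - {}. g q = (0, 0))}"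
      proof
        fix s assume "s \<in> Poly_Mapping.keys f"
        then obtain u g v where "s = Some (u, g, v)" "u \<in> lists (letters P)" "g \<in> carrier G"
          "v \<in> lists (letters P)"
          using fA by (cases s) auto
        moreover from this have "u = []" "v = []"
          using True by (cases u; cases v; simp add: letters_def)+
        ultimately show "s \<in> {Some ([], g, []) | g. g \<in> carrier G \<and> (\<forall>q\<in>P - {}. g q = (0, 0))}"
          using True by blast
      qed
      show ?thesis by (rule one_in_ideal[OF I char finite.emptyI empty_subsetI f keys])
    next
      case False
      then obtain p where p: "p \<in> P" by blast
      obtain f' u v where f': "f' \<in> I" "f' \<noteq> 0" and keys:
        "Poly_Mapping.keys f' \<subseteq> (\<lambda>g. Some ([], g(p := (0, 0)), [])) ` {g. Some (u, g, v) \<in> Poly_Mapping.keys f}"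
        by (rule ideal_project[OF I char f p])
      \<comment> \<open>These are the primes occurring in \<open>f'\<close>, finitely many because
        each group element has finite support.\<close>
      define Q where "Q = (\<Union>s\<in>Poly_Mapping.keys f'. case s of None \<Rightarrow> {} | Some (u, g, v) \<Rightarrow> {q \<in> P. g q \<noteq> (0, 0)})"
      have in_G: "\<exists>g\<in>carrier G. s = Some ([], g, [])" if "s \<in> Poly_Mapping.keys f'" for s
      proof -
        note s = that
        obtain g where "s = Some ([], g(p := (0, 0)), [])" "Some (u, g, v) \<in> Poly_Mapping.keys f"
          using keys s by blast
        moreover from this have "g \<in> carrier G" using keys_in_hull(2) I.a_subset f(1) by blast
        ultimately show ?thesis using kill_in_G p by blast
      qed
      have fin: "finite Q"
        unfolding Q_def
      proof (rule finite_UN_I[OF finite_keys])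
        fix s assume "s \<in> Poly_Mapping.keys f'"
        then obtain g where "g \<in> carrier G" "s = Some ([], g, [])" using in_G by blast
        then show "finite (case s of None \<Rightarrow> {} | Some (u, g, v) \<Rightarrow> {q \<in> P. g q \<noteq> (0, 0)})"
          by (simp add: carrier_G)
      qed
      have sub: "Q \<subseteq> P" by (auto simp: Q_def split: option.splits)
      have "Poly_Mapping.keys f' \<subseteq>
          {Some ([], g, []) | g. g \<in> carrier G \<and> (\<forall>q\<in>P - Q. g q = (0, 0))}"
      proof
        fix s assume s: "s \<in> Poly_Mapping.keys f'"
        then obtain g where g: "g \<in> carrier G" "s = Some ([], g, [])" using in_G by blast
        have "q \<in> Q" if "q \<in> P" "g q \<noteq> (0, 0)" for q
          unfolding Q_def by (rule UN_I[OF s]) (simp add: g that)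
        then have "\<forall>q\<in>P - Q. g q = (0, 0)" by blast
        then show "s \<in> {Some ([], g, []) | g. g \<in> carrier G \<and> (\<forall>q\<in>P - Q. g q = (0, 0))}"
          using g by blast
      qed
      then show ?thesis by (rule one_in_ideal[OF I char fin sub f'])
    qed
    then show ?thesis using I.one_imp_carrier by blast
  qed simp
qed

subsection \<open>Characteristic in \<open>\<P>\<close>\<close>

definition embed :: "nat \<Rightarrow> int \<times> int \<Rightarrow> elt"
  where "embed p v = \<one>\<^bsub>G\<^esub>(p := v)"

definition V :: "nat \<Rightarrow> (int \<times> int) monoid"
  where "V p = integer_mod_group p \<times>\<times> integer_mod_group p"

lemma carrier_V: "p \<in> P \<Longrightarrow> carrier (V p) = {0..<int p} \<times> {0..<int p}"
  using pos[of p] by (simp add: V_def carrier_integer_mod_group)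

lemma mult_V: "v \<otimes>\<^bsub>V p\<^esub> w = ((fst v + fst w) mod int p, (snd v + snd w) mod int p)"
  by (simp add: V_def DirProd_def case_prod_beta)

lemma one_V: "\<one>\<^bsub>V p\<^esub> = (0, 0)"
  by (simp add: V_def)

lemma embed_in_G [simp]: "p \<in> P \<Longrightarrow> v \<in> carrier (V p) \<Longrightarrow> embed p v \<in> carrier G"
  unfolding embed_def by (rule upd_in_G) (simp_all add: carrier_V)

lemma group_V: "group (V p)"
  by (simp add: V_def DirProd_group)

lemma embed_hom: "p \<in> P \<Longrightarrow> embed p \<in> hom (V p) G"
proof (rule homI)
  fix v w assume p: "p \<in> P" and vw: "v \<in> carrier (V p)" "w \<in> carrier (V p)"
  then have "v \<otimes>\<^bsub>V p\<^esub> w \<in> carrier (V p)"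
    using group_V by (simp add: group.is_monoid monoid.m_closed)
  then show "embed p (v \<otimes>\<^bsub>V p\<^esub> w) = embed p v \<otimes>\<^bsub>G\<^esub> embed p w"
    using p vw
    by (intro G_eqI G.m_closed embed_in_G) (auto simp: mult_G embed_def one_G mult_V)
qed simp

lemma embed_kill: "p \<in> P \<Longrightarrow> (embed p v)(q := (0, 0)) = (if q = p then \<one>\<^bsub>G\<^esub> else embed p v)" if "q \<in> P"
  using that by (auto simp: embed_def fun_eq_iff one_G)

text \<open>Since \<open>q\<close> is invertible modulo \<open>p\<close>, \<open>embed p v\<close>
  is a \<open>q\<close>-th power, and \<open>q\<close>-th powers lie in every subgroup of index
  \<open>q\<close>.\<close>

lemma embed_in_subgroup:
  assumes pq: "p \<in> P" "q \<in> P" "p \<noteq> q" and v: "v \<in> carrier (V p)"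
    and H: "subgroup H G" "card (lcosets\<^bsub>G\<^esub> H) = q"
  shows "embed p v \<in> H"
proof -
  have "coprime (int q) (int p)"
    using pq prime by (simp add: primes_coprime)
  then obtain c where c: "[int q * c = 1] (mod int p)" using cong_solve_coprime_int by blast
  define v' where "v' = (c * fst v mod int p, c * snd v mod int p)"
  have v': "v' \<in> carrier (V p)" using pq by (simp add: v'_def carrier_V)
  have eq: "(int q * (c * a mod int p)) mod int p = a" if "a \<in> {0..<int p}" for a
  proof -
    have "(int q * (c * a mod int p)) mod int p = (int q * c * a) mod int p"
      by (simp add: mod_mult_right_eq mult.assoc)
    also have "\<dots> = (1 * a) mod int p"
      using cong_mult[OF c cong_refl[of a]] by (simp add: cong_def)
    also have "\<dots> = a" using that by simp
    finally show ?thesis .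
  qed
  have pow: "v' [^]\<^bsub>V p\<^esub> n = ((int n * fst v') mod int p, (int n * snd v') mod int p)" for n :: nat
  proof (induction n)
    case (Suc n)
    then show ?case
      by (simp add: nat_pow_Suc mult_V mod_add_left_eq) (simp add: algebra_simps)
  qed (simp add: one_V)
  have "v' [^]\<^bsub>V p\<^esub> q = v"
  proof -
    have "fst v \<in> {0..<int p}" "snd v \<in> {0..<int p}"
      using v pq by (simp_all add: carrier_V mem_Times_iff)
    then show ?thesis unfolding pow by (simp only: v'_def fst_conv snd_conv eq prod.collapse)
  qed
  then have "embed p v = embed p v' [^]\<^bsub>G\<^esub> q"
    using hom_nat_pow[OF embed_hom v' group_V G.is_group] pq by metis
  also have "\<dots> \<in> H"
    using G.pow_index_in_subgroup[OF H(1) embed_in_G[OF pq(1) v']] H(2) by simp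
  finally show ?thesis .
qed

text \<open>All \<open>p * p\<close> elements fix the empty word. A first letter over
  \<open>p\<close> is moved, but restriction there gives the identity, so the tail is fixed and the
  fibre is that of a single coset. A first letter over another prime is fixed and the restriction
  changes nothing, so the count passes to the tail.\<close>

lemma dvd_card_word_fibre:
  assumes p: "p \<in> P"
  shows "w \<in> lists (letters P) \<Longrightarrow> p dvd card {v \<in> carrier (V p). embed p v \<bullet> w = w'}"
proof (induction w arbitrary: w')
  case Nil
  show ?case
  proof (cases "w' = []")
    case True
    then show ?thesis using p by (simp add: carrier_V)
  qed simp
next
  case (Cons x w)
  then have "x \<in> letters P" by simp
  then obtain q H C i where x: "x = ((q, H, C), i)" "q \<in> P" "subgroup H G"
      "card (lcosets\<^bsub>G\<^esub> H) = q" "C \<in> lcosets\<^bsub>G\<^esub> H"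
    by (rule lettersE)
  show ?case
  proof (cases "q = p")
    case True
    have act: "embed p v \<bullet> (x # w) = ((p, H, embed p v <#\<^bsub>G\<^esub> C), i) # w" for v
      using Cons.prems x p True by (simp add: embed_kill)
    show ?thesis
    proof (cases "\<exists>C'. w' = ((p, H, C'), i) # w")
      case True
      then obtain C' where "w' = ((p, H, C'), i) # w" by blast
      then have "{v \<in> carrier (V p). embed p v \<bullet> (x # w) = w'} =
          {v \<in> carrier (V p). embed p v <#\<^bsub>G\<^esub> C = C'}"
        unfolding act by simp
      moreover have "order (V p) = p * p"
        using p by (simp add: order_def carrier_V)
      then have "p dvd card {v \<in> carrier (V p). embed p v <#\<^bsub>G\<^esub> C = C'}"
        using x \<open>q = p\<close> by (intro G.prime_dvd_card_fibre[OF prime[OF p] group_V _ embed_hom[OF p]]) simp_all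
      ultimately show ?thesis by simp
    next
      case False
      then have "{v \<in> carrier (V p). embed p v \<bullet> (x # w) = w'} = {}"
        unfolding act by auto
      then show ?thesis by (simp only: card.empty dvd_0_right)
    qed
  next
    case False
    have act: "embed p v \<bullet> (x # w) = x # embed p v \<bullet> w" if v: "v \<in> carrier (V p)" for v
    proof -
      have "embed p v \<in> H" using embed_in_subgroup p x False v by metis
      then have "inv\<^bsub>G\<^esub> \<one>\<^bsub>G\<^esub> \<otimes>\<^bsub>G\<^esub> embed p v \<in> H" using p v by simp
      then have "\<one>\<^bsub>G\<^esub> <#\<^bsub>G\<^esub> C = embed p v <#\<^bsub>G\<^esub> C"
        using G.lcos_lcoset_eq_iff[OF x(3,5)] p v by simp
      moreover have "C \<subseteq> carrier G"
        using subgroup.lcosets_carrier[OF x(3) G.is_group x(5)] .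
      ultimately have "embed p v <#\<^bsub>G\<^esub> C = C" by (simp add: G.lcos_mult_one)
      then show ?thesis using x p False by (simp add: embed_kill)
    qed
    show ?thesis
    proof (cases "\<exists>y. w' = x # y")
      case True
      then obtain y where "w' = x # y" by blast
      then have "{v \<in> carrier (V p). embed p v \<bullet> (x # w) = w'} =
          {v \<in> carrier (V p). embed p v \<bullet> w = y}"
        using act by auto
      then show ?thesis using Cons by simp
    next
      case False
      then have "{v \<in> carrier (V p). embed p v \<bullet> (x # w) = w'} = {}"
        using act by auto
      then show ?thesis by (simp only: card.empty dvd_0_right)
    qed
  qed
qed

lemma not_simple_if_char:
  assumes char: "CHAR('k::field) \<in> P"
  shows "\<not> simple_algebra (A.algebra :: ('k, _) module)"
proof -
  define p where "p = CHAR('k)"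
  have p: "p \<in> P" using char by (simp add: p_def)
  have fin: "finite (carrier (V p))" using p by (simp add: carrier_V)
  define f :: "(letter list \<times> elt \<times> letter list) option \<Rightarrow>\<^sub>0 'k"
    where "f = (\<Sum>v\<in>carrier (V p). Poly_Mapping.single (Some ([], embed p v, [])) 1)"
  have fA: "f \<in> carrier A.algebra"
    unfolding f_def using p by (intro A.sum_in_algebra A.single_in_algebra) simp
  have "word_coeff f w w' = 0" if w: "w \<in> lists (letters P)" for w w'
  proof -
    \<comment> \<open>Each matrix entry counts a fibre, hence is a multiple of the
      characteristic.\<close>
    have "word_coeff f w w' = (\<Sum>v\<in>carrier (V p). if embed p v \<bullet> w = w' then 1 else 0)"
      unfolding f_def word_coeff_sum by (simp add: word_coeff_single hull_word_act_Some)
    also have "\<dots> = of_nat (card {v \<in> carrier (V p). embed p v \<bullet> w = w'})"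
      using fin by (simp add: sum.inter_filter[symmetric])
    also have "\<dots> = 0"
      using dvd_card_word_fibre[OF p w] by (simp add: of_nat_eq_0_iff_char_dvd p_def)
    finally show ?thesis .
  qed
  then have "f \<in> word_kernel" using fA by (simp add: word_kernel_def)
  moreover have "f \<noteq> 0"
  proof
    \<comment> \<open>Only \<open>v = (0, 0)\<close> embeds to the identity, so the coefficient of
      \<open>f\<close> there is 1.\<close>
    have inj: "embed p v = \<one>\<^bsub>G\<^esub> \<longleftrightarrow> v = (0, 0)" for v
      using p by (auto simp: embed_def fun_eq_iff one_G)
    assume "f = 0"
    then have "0 = Poly_Mapping.lookup f (Some ([], \<one>\<^bsub>G\<^esub>, []))" by simp
    also have "\<dots> = (\<Sum>v\<in>carrier (V p). if v = (0, 0) then 1 else 0)"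
      unfolding f_def lookup_sum by (intro sum.cong) (auto simp: lookup_single when_def inj)
    also have "\<dots> = 1" using fin p by (simp add: carrier_V)
    finally show False by simp
  qed
  ultimately show ?thesis by (rule not_simple_if_word_kernel)
qed

end

theorem theorem6p9:
  fixes P :: "nat set"
  assumes "\<forall>p\<in>P. prime p"
  shows "(simple_algebra (contracted_algebra (semigroup_of P) None ::
            ('k::field, (letter list \<times> elt \<times> letter list) option \<Rightarrow>\<^sub>0 'k) module)
          \<longleftrightarrow> CHAR('k) \<notin> P) \<and>
         (P = {p. prime p} \<longrightarrow>
           (simple_algebra (contracted_algebra (semigroup_of P) None ::
              ('k, (letter list \<times> elt \<times> letter list) option \<Rightarrow>\<^sub>0 'k) module)
            \<longleftrightarrow> CHAR('k) = 0))"
proof -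
  interpret prime_set P
    using assms by unfold_locales blast
  have simple: "simple_algebra (contracted_algebra (semigroup_of P) None ::
      ('k, (letter list \<times> elt \<times> letter list) option \<Rightarrow>\<^sub>0 'k) module) \<longleftrightarrow> CHAR('k) \<notin> P"
    unfolding semigroup_of_eq using simple_if_char not_simple_if_char by blast
  \<comment> \<open>The characteristic of a field is zero or prime.\<close>
  have "CHAR('k) \<notin> {p. prime p} \<longleftrightarrow> CHAR('k) = 0"
    using prime_CHAR_semidom[where 'a = 'k] by auto
  with simple show ?thesis by metis
qed

end
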